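(* Let $A$ and $B$ be groups and let $G = A \ast B$ be their free product. Then $G$ is order separable if and only if both $A$ and $B$ are order separable.
   Context: A group $G$ is called order separable if for all elements $u, v \in G$ such that $u$ is conjugate in $G$ to neither $v$ nor $v^{-1}$, there exists a homomorphism $\varphi$ of $G$ onto a finite group such that the orders of the elements $\varphi(u)$ and $\varphi(v)$ are different. *)

theory Defs
  imports "HOL-Algebra.Multiplicative_Group"
begin

section \<open>Order separable groups\<close>

definition conjugate_in :: "('a, 'm) monoid_scheme \<Rightarrow> 'a \<Rightarrow> 'a \<Rightarrow> bool" where
  "conjugate_in G u v \<longleftrightarrow>
     (\<exists>g\<in>carrier G. v = g \<otimes>\<^bsub>G\<^esub> u \<otimes>\<^bsub>G\<^esub> inv\<^bsub>G\<^esub> g)"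

text \<open>
  The finite quotient is taken with elements in \<open>nat\<close>, because a definition cannot quantify over
  types. Every finite group is isomorphic to such a group, so nothing is lost; see
  \<open>order_separableI\<close> below.
\<close>

definition order_separable :: "('a, 'm) monoid_scheme \<Rightarrow> bool" where
  "order_separable G \<longleftrightarrow>
     (\<forall>u\<in>carrier G. \<forall>v\<in>carrier G.
        \<not> conjugate_in G u v \<and> \<not> conjugate_in G u (inv\<^bsub>G\<^esub> v) \<longrightarrow>
        (\<exists>(H :: nat monoid) \<phi>. group H \<and> finite (carrier H) \<and> \<phi> \<in> epi G H \<and>
            group.ord H (\<phi> u) \<noteq> group.ord H (\<phi> v)))"

lemma order_separableI:
  assumes "\<And>u v. \<lbrakk>u \<in> carrier G; v \<in> carrier G; \<not> conjugate_in G u v; \<not> conjugate_in G u (inv\<^bsub>G\<^esub> v)\<rbrakk>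
     \<Longrightarrow> \<exists>(H :: ('b, 'n) monoid_scheme) \<phi>. group H \<and> finite (carrier H) \<and> \<phi> \<in> epi G H \<and>
            group.ord H (\<phi> u) \<noteq> group.ord H (\<phi> v)"
  shows "order_separable G"
  unfolding order_separable_def
proof (intro ballI impI)
  fix u v
  assume u: "u \<in> carrier G" and v: "v \<in> carrier G"
    and "\<not> conjugate_in G u v \<and> \<not> conjugate_in G u (inv\<^bsub>G\<^esub> v)"
  then obtain H :: "('b, 'n) monoid_scheme" and \<phi> where H: "group H" "finite (carrier H)"
    and \<phi>: "\<phi> \<in> epi G H" and ne: "group.ord H (\<phi> u) \<noteq> group.ord H (\<phi> v)"
    using assms[of u v] by blast
  interpret H: group H by fact
  obtain f :: "'b \<Rightarrow> nat" where f: "inj_on f (carrier H)"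
    using finite_imp_inj_to_nat_seg[OF H(2)] by blast
  define g where "g = inv_into (carrier H) f"
  have g: "g (f x) = x" if "x \<in> carrier H" for x
    using that f by (simp add: g_def)
  define K where "K = \<lparr>carrier = f ` carrier H, mult = (\<lambda>x y. f (g x \<otimes>\<^bsub>H\<^esub> g y)), one = f \<one>\<^bsub>H\<^esub>\<rparr>"
  have K: "group K"
  proof (rule groupI)
    fix x assume "x \<in> carrier K"
    then obtain a where "a \<in> carrier H" "x = f a" by (auto simp: K_def)
    then show "\<exists>y\<in>carrier K. y \<otimes>\<^bsub>K\<^esub> x = \<one>\<^bsub>K\<^esub>"
      by (intro bexI[of _ "f (inv\<^bsub>H\<^esub> a)"]) (auto simp: K_def g)
  qed (auto simp: K_def g H.m_assoc)
  interpret K: group K by fact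
  have fH: "f \<in> iso H K"
    using f by (auto simp: iso_def hom_def bij_betw_def K_def g)
  have ord: "K.ord (f x) = H.ord x" if x: "x \<in> carrier H" for x
  proof -
    have gh: "group_hom H K f"
      using fH by (simp add: group_hom_def group_hom_axioms_def iso_def H.group_axioms K)
    have fx: "f x \<in> carrier K" using x by (simp add: K_def)
    have "f x [^]\<^bsub>K\<^esub> n = \<one>\<^bsub>K\<^esub> \<longleftrightarrow> H.ord x dvd n" for n :: nat
    proof -
      have "f x [^]\<^bsub>K\<^esub> n = f (x [^]\<^bsub>H\<^esub> n)"
        using group_hom.hom_nat_pow[OF gh x, of n] by simp
      moreover have "\<one>\<^bsub>K\<^esub> = f \<one>\<^bsub>H\<^esub>" by (simp add: K_def)
      ultimately show ?thesis
        using f x by (auto simp: inj_on_eq_iff H.pow_eq_id)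
    qed
    then show ?thesis using K.ord_unique[OF fx] by blast
  qed
  have "f \<circ> \<phi> \<in> epi G K"
    using \<phi> fH epi_compose iso_iff_mon_epi by blast
  moreover have "finite (carrier K)" using H(2) by (simp add: K_def)
  moreover have "\<phi> u \<in> carrier H" "\<phi> v \<in> carrier H"
    using \<phi> u v by (auto simp: epi_def)
  ultimately show "\<exists>(H :: nat monoid) \<phi>. group H \<and> finite (carrier H) \<and> \<phi> \<in> epi G H \<and>
            group.ord H (\<phi> u) \<noteq> group.ord H (\<phi> v)"
    using K ne by (intro exI[of _ K] exI[of _ "f \<circ> \<phi>"]) (simp add: ord)
qed


section \<open>Free products\<close>

text \<open>
  The free product of \<open>A\<close> and \<open>B\<close> is realised on reduced words: lists of non-trivial elements
  of \<open>A\<close> and of \<open>B\<close> in which the two factors alternate. The product of two words is their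
  concatenation, reduced at the seam.
\<close>

definition reduced_word :: "('a, 'm) monoid_scheme \<Rightarrow> ('b, 'n) monoid_scheme \<Rightarrow> ('a + 'b) list \<Rightarrow> bool" where
  "reduced_word A B w \<longleftrightarrow>
     set w \<subseteq> (carrier A - {\<one>\<^bsub>A\<^esub>}) <+> (carrier B - {\<one>\<^bsub>B\<^esub>}) \<and>
     successively (\<lambda>x y. isl x \<noteq> isl y) w"

fun reduced_Cons ::
  "('a, 'm) monoid_scheme \<Rightarrow> ('b, 'n) monoid_scheme \<Rightarrow> 'a + 'b \<Rightarrow> ('a + 'b) list \<Rightarrow> ('a + 'b) list" where
  "reduced_Cons A B (Inl a) (Inl a' # w) =
     (if a \<otimes>\<^bsub>A\<^esub> a' = \<one>\<^bsub>A\<^esub> then w else Inl (a \<otimes>\<^bsub>A\<^esub> a') # w)"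
| "reduced_Cons A B (Inr b) (Inr b' # w) =
     (if b \<otimes>\<^bsub>B\<^esub> b' = \<one>\<^bsub>B\<^esub> then w else Inr (b \<otimes>\<^bsub>B\<^esub> b') # w)"
| "reduced_Cons A B (Inl a) w = (if a = \<one>\<^bsub>A\<^esub> then w else Inl a # w)"
| "reduced_Cons A B (Inr b) w = (if b = \<one>\<^bsub>B\<^esub> then w else Inr b # w)"

definition free_product ::
  "('a, 'm) monoid_scheme \<Rightarrow> ('b, 'n) monoid_scheme \<Rightarrow> ('a + 'b) list monoid" where
  "free_product A B =
     \<lparr>carrier = {w. reduced_word A B w},
      mult = foldr (reduced_Cons A B),
      one = []\<rparr>"

definition free_product_inl :: "('a, 'm) monoid_scheme \<Rightarrow> 'a \<Rightarrow> ('a + 'b) list" where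
  "free_product_inl A a = (if a = \<one>\<^bsub>A\<^esub> then [] else [Inl a])"

definition free_product_inr :: "('b, 'n) monoid_scheme \<Rightarrow> 'b \<Rightarrow> ('a + 'b) list" where
  "free_product_inr B b = (if b = \<one>\<^bsub>B\<^esub> then [] else [Inr b])"


subsection \<open>Group structure and universal property\<close>

lemma reduced_word_Nil [simp]: "reduced_word A B []"
  by (simp add: reduced_word_def)

lemma reduced_word_Cons:
  "reduced_word A B (x # w) \<longleftrightarrow>
     x \<in> (carrier A - {\<one>\<^bsub>A\<^esub>}) <+> (carrier B - {\<one>\<^bsub>B\<^esub>}) \<and>
     (w = [] \<or> isl x \<noteq> isl (hd w)) \<and> reduced_word A B w"
  by (auto simp: reduced_word_def successively_Cons)

locale two_groups = A: group A + B: group B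
  for A :: "('a, 'm) monoid_scheme" and B :: "('b, 'n) monoid_scheme"
begin

abbreviation letters :: "('a + 'b) set" where
  "letters \<equiv> carrier A <+> carrier B"

lemma letters_of_reduced: "reduced_word A B w \<Longrightarrow> set w \<subseteq> letters"
  by (auto simp: reduced_word_def)

lemma reduced_Cons_closed:
  assumes "x \<in> letters" "reduced_word A B w"
  shows "reduced_word A B (reduced_Cons A B x w)"
  using assms
  by (cases "(A, B, x, w)" rule: reduced_Cons.cases) (auto simp: reduced_word_Cons)

lemma reduced_Cons_reduced:
  assumes "reduced_word A B (x # w)"
  shows "reduced_Cons A B x w = x # w"
  using assms
  by (cases "(A, B, x, w)" rule: reduced_Cons.cases) (auto simp: reduced_word_Cons)

lemma reduced_Cons_one:
  assumes "reduced_word A B w"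
  shows "reduced_Cons A B (Inl \<one>\<^bsub>A\<^esub>) w = w" "reduced_Cons A B (Inr \<one>\<^bsub>B\<^esub>) w = w"
proof -
  show "reduced_Cons A B (Inl \<one>\<^bsub>A\<^esub>) w = w"
    using assms
    by (cases "(A, B, Inl \<one>\<^bsub>A\<^esub> :: 'a + 'b, w)" rule: reduced_Cons.cases)
       (auto simp: reduced_word_Cons)
  show "reduced_Cons A B (Inr \<one>\<^bsub>B\<^esub>) w = w"
    using assms
    by (cases "(A, B, Inr \<one>\<^bsub>B\<^esub> :: 'a + 'b, w)" rule: reduced_Cons.cases)
       (auto simp: reduced_word_Cons)
qed

lemma reduced_Cons_Inl_Nil_or_Inr:
  assumes "w = [] \<or> \<not> isl (hd w)"
  shows "reduced_Cons A B (Inl a) w = (if a = \<one>\<^bsub>A\<^esub> then w else Inl a # w)"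
  using assms by (cases "(A, B, Inl a :: 'a + 'b, w)" rule: reduced_Cons.cases) auto

lemma reduced_Cons_Inr_Nil_or_Inl:
  assumes "w = [] \<or> isl (hd w)"
  shows "reduced_Cons A B (Inr b) w = (if b = \<one>\<^bsub>B\<^esub> then w else Inr b # w)"
  using assms by (cases "(A, B, Inr b :: 'a + 'b, w)" rule: reduced_Cons.cases) auto

lemma reduced_Cons_Inl_mult:
  assumes a: "a \<in> carrier A" and a': "a' \<in> carrier A" and w: "reduced_word A B w"
  shows "reduced_Cons A B (Inl a) (reduced_Cons A B (Inl a') w) =
         reduced_Cons A B (Inl (a \<otimes>\<^bsub>A\<^esub> a')) w"
proof (cases "w = [] \<or> \<not> isl (hd w)")
  case True
  then show ?thesis
    using a a' by (auto simp: reduced_Cons_Inl_Nil_or_Inr)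
next
  case False
  then obtain c w' where ww: "w = Inl c # w'"
    by (cases w) (auto simp: isl_def)
  have c: "c \<in> carrier A" and w': "w' = [] \<or> \<not> isl (hd w')"
    using w by (auto simp: ww reduced_word_Cons)
  have "a \<otimes>\<^bsub>A\<^esub> a' \<otimes>\<^bsub>A\<^esub> c = a" if "a' \<otimes>\<^bsub>A\<^esub> c = \<one>\<^bsub>A\<^esub>"
    using that a a' c by (simp add: A.m_assoc)
  then show ?thesis
    using a a' c w' by (auto simp: ww reduced_Cons_Inl_Nil_or_Inr A.m_assoc)
qed

lemma reduced_Cons_Inr_mult:
  assumes b: "b \<in> carrier B" and b': "b' \<in> carrier B" and w: "reduced_word A B w"
  shows "reduced_Cons A B (Inr b) (reduced_Cons A B (Inr b') w) =
         reduced_Cons A B (Inr (b \<otimes>\<^bsub>B\<^esub> b')) w"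
proof (cases "w = [] \<or> isl (hd w)")
  case True
  then show ?thesis
    using b b' by (auto simp: reduced_Cons_Inr_Nil_or_Inl)
next
  case False
  then obtain c w' where ww: "w = Inr c # w'"
    by (cases w; cases "hd w") auto
  have c: "c \<in> carrier B" and w': "w' = [] \<or> isl (hd w')"
    using w by (auto simp: ww reduced_word_Cons)
  have "b \<otimes>\<^bsub>B\<^esub> b' \<otimes>\<^bsub>B\<^esub> c = b" if "b' \<otimes>\<^bsub>B\<^esub> c = \<one>\<^bsub>B\<^esub>"
    using that b b' c by (simp add: B.m_assoc)
  then show ?thesis
    using b b' c w' by (auto simp: ww reduced_Cons_Inr_Nil_or_Inl B.m_assoc)
qed

lemma foldr_reduced_Cons_closed:
  assumes "set u \<subseteq> letters" "reduced_word A B w"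
  shows "reduced_word A B (foldr (reduced_Cons A B) u w)"
  using assms by (induction u) (auto intro: reduced_Cons_closed)

lemma foldr_reduced_Cons_Nil:
  "reduced_word A B u \<Longrightarrow> foldr (reduced_Cons A B) u [] = u"
  by (induction u) (auto simp: reduced_word_Cons intro!: reduced_Cons_reduced)

lemma foldr_reduced_Cons_step:
  assumes x: "x \<in> letters" and u: "reduced_word A B u" and w: "reduced_word A B w"
  shows "foldr (reduced_Cons A B) (reduced_Cons A B x u) w =
         reduced_Cons A B x (foldr (reduced_Cons A B) u w)"
proof -
  have r: "reduced_word A B (foldr (reduced_Cons A B) v w)" if "reduced_word A B v" for v
    using foldr_reduced_Cons_closed[OF letters_of_reduced[OF that] w] .
  show ?thesis
  proof (cases x)
    case (Inl a)
    show ?thesis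
    proof (cases "u = [] \<or> \<not> isl (hd u)")
      case True
      then show ?thesis
        using Inl r[OF u] by (auto simp: reduced_Cons_Inl_Nil_or_Inr reduced_Cons_one)
    next
      case False
      then obtain c u' where uu: "u = Inl c # u'"
        by (cases u) (auto simp: isl_def)
      have c: "c \<in> carrier A" and a: "a \<in> carrier A" and u': "reduced_word A B u'"
        using u x Inl by (auto simp: uu reduced_word_Cons)
      show ?thesis
        using reduced_Cons_Inl_mult[OF a c r[OF u']] reduced_Cons_one(1)[OF r[OF u']]
        by (auto simp: uu Inl)
    qed
  next
    case (Inr b)
    show ?thesis
    proof (cases "u = [] \<or> isl (hd u)")
      case True
      then show ?thesis
        using Inr r[OF u] by (auto simp: reduced_Cons_Inr_Nil_or_Inl reduced_Cons_one)
    next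
      case False
      then obtain c u' where uu: "u = Inr c # u'"
        by (cases u; cases "hd u") auto
      have c: "c \<in> carrier B" and b: "b \<in> carrier B" and u': "reduced_word A B u'"
        using u x Inr by (auto simp: uu reduced_word_Cons)
      show ?thesis
        using reduced_Cons_Inr_mult[OF b c r[OF u']] reduced_Cons_one(2)[OF r[OF u']]
        by (auto simp: uu Inr)
    qed
  qed
qed

lemma foldr_reduced_Cons_assoc:
  assumes "set u \<subseteq> letters" "reduced_word A B v" "reduced_word A B w"
  shows "foldr (reduced_Cons A B) (foldr (reduced_Cons A B) u v) w =
         foldr (reduced_Cons A B) u (foldr (reduced_Cons A B) v w)"
  using assms
  by (induction u) (auto simp: foldr_reduced_Cons_step foldr_reduced_Cons_closed)

lemma free_product_left_inverse:
  assumes "reduced_word A B w"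
  shows "\<exists>v. reduced_word A B v \<and> foldr (reduced_Cons A B) v w = []"
  using assms
proof (induction w)
  case Nil
  show ?case by (intro exI[of _ "[]"]) simp
next
  case (Cons x w)
  then obtain v where v: "reduced_word A B v" "foldr (reduced_Cons A B) v w = []"
    by (auto simp: reduced_word_Cons)
  define y where "y = map_sum (m_inv A) (m_inv B) x"
  have x: "x \<in> letters" using Cons.prems letters_of_reduced by fastforce
  then have y: "y \<in> letters" by (auto simp: y_def)
  have yx: "reduced_Cons A B y (x # w) = w"
    using x by (auto simp: y_def)
  have ry: "reduced_word A B (reduced_Cons A B y [])"
    using y by (intro reduced_Cons_closed) auto
  have "foldr (reduced_Cons A B) (foldr (reduced_Cons A B) v (reduced_Cons A B y [])) (x # w) =
        foldr (reduced_Cons A B) v (foldr (reduced_Cons A B) (reduced_Cons A B y []) (x # w))"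
    using foldr_reduced_Cons_assoc[OF letters_of_reduced[OF v(1)] ry Cons.prems] .
  also have "foldr (reduced_Cons A B) (reduced_Cons A B y []) (x # w) = w"
    using foldr_reduced_Cons_step[OF y _ Cons.prems, of "[]"] yx by simp
  finally show ?case
    using v(2) foldr_reduced_Cons_closed[OF letters_of_reduced[OF v(1)] ry] by auto
qed

lemma group_free_product: "group (free_product A B)"
proof (rule groupI)
  fix w assume "w \<in> carrier (free_product A B)"
  then show "\<exists>v\<in>carrier (free_product A B). v \<otimes>\<^bsub>free_product A B\<^esub> w = \<one>\<^bsub>free_product A B\<^esub>"
    using free_product_left_inverse by (auto simp: free_product_def)
qed (auto simp: free_product_def foldr_reduced_Cons_assoc dest: letters_of_reduced
       intro!: foldr_reduced_Cons_closed)

lemma free_product_inl_hom: "free_product_inl A \<in> hom A (free_product A B)"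
  by (auto simp: hom_def free_product_def free_product_inl_def reduced_word_Cons)

lemma free_product_inr_hom: "free_product_inr B \<in> hom B (free_product A B)"
  by (auto simp: hom_def free_product_def free_product_inr_def reduced_word_Cons)

definition free_product_lift :: "('c, 'k) monoid_scheme \<Rightarrow> ('a \<Rightarrow> 'c) \<Rightarrow> ('b \<Rightarrow> 'c) \<Rightarrow> ('a + 'b) list \<Rightarrow> 'c" where
  "free_product_lift H f g w = foldr (\<lambda>x h. case_sum f g x \<otimes>\<^bsub>H\<^esub> h) w \<one>\<^bsub>H\<^esub>"

lemma free_product_lift:
  assumes H: "group H" and f: "f \<in> hom A H" and g: "g \<in> hom B H"
  shows "free_product_lift H f g \<in> hom (free_product A B) H"
    and "a \<in> carrier A \<Longrightarrow> free_product_lift H f g (free_product_inl A a) = f a"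
    and "b \<in> carrier B \<Longrightarrow> free_product_lift H f g (free_product_inr B b) = g b"
proof -
  interpret H: group H by fact
  interpret f: group_hom A H f using f by unfold_locales
  interpret g: group_hom B H g using g by unfold_locales
  let ?l = "free_product_lift H f g" and ?c = "case_sum f g"
  have Cons: "?l (x # w) = ?c x \<otimes>\<^bsub>H\<^esub> ?l w" for x w
    by (simp add: free_product_lift_def)
  have Nil: "?l [] = \<one>\<^bsub>H\<^esub>" by (simp add: free_product_lift_def)
  have cl: "?l w \<in> carrier H" if "set w \<subseteq> letters" for w
    using that by (induction w) (auto simp: Nil Cons)
  have step: "?l (reduced_Cons A B x w) = ?c x \<otimes>\<^bsub>H\<^esub> ?l w"
    if "x \<in> letters" "set w \<subseteq> letters" for x w
    using that cl
  proof (cases "(A, B, x, w)" rule: reduced_Cons.cases)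
    case (1 A' B' a a' w')
    have xw: "x = Inl a" "w = Inl a' # w'" using 1 by simp_all
    have aa: "a \<in> carrier A" "a' \<in> carrier A" "?l w' \<in> carrier H"
      using that cl 1 by auto
    have "f a \<otimes>\<^bsub>H\<^esub> (f a' \<otimes>\<^bsub>H\<^esub> ?l w') = f (a \<otimes>\<^bsub>A\<^esub> a') \<otimes>\<^bsub>H\<^esub> ?l w'"
      using aa by (simp add: H.m_assoc)
    then show ?thesis
      using aa xw H.l_one[of "?l w'"] by (auto simp: Cons f.hom_one simp del: f.hom_mult)
  next
    case (2 A' B' b b' w')
    have xw: "x = Inr b" "w = Inr b' # w'" using 2 by simp_all
    have bb: "b \<in> carrier B" "b' \<in> carrier B" "?l w' \<in> carrier H"
      using that cl 2 by auto
    have "g b \<otimes>\<^bsub>H\<^esub> (g b' \<otimes>\<^bsub>H\<^esub> ?l w') = g (b \<otimes>\<^bsub>B\<^esub> b') \<otimes>\<^bsub>H\<^esub> ?l w'"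
      using bb by (simp add: H.m_assoc)
    then show ?thesis
      using bb xw H.l_one[of "?l w'"] by (auto simp: Cons g.hom_one simp del: g.hom_mult)
  qed (auto simp: Cons Nil)
  have "?l (foldr (reduced_Cons A B) u w) = ?l u \<otimes>\<^bsub>H\<^esub> ?l w"
    if "set u \<subseteq> letters" "reduced_word A B w" for u w
    using that(1)
  proof (induction u)
    case Nil
    then show ?case using cl[OF letters_of_reduced[OF that(2)]] by (simp add: \<open>?l [] = _\<close>)
  next
    case (Cons x u)
    have r: "reduced_word A B (foldr (reduced_Cons A B) u w)"
      using foldr_reduced_Cons_closed Cons.prems that(2) by auto
    have "?c x \<in> carrier H" using Cons.prems by auto
    then show ?case
      using Cons step[OF _ letters_of_reduced[OF r], of x] cl[of u] cl[OF letters_of_reduced[OF that(2)]]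
      by (simp add: \<open>\<And>x w. ?l (x # w) = _\<close> H.m_assoc)
  qed
  then show "?l \<in> hom (free_product A B) H"
    using cl by (auto simp: hom_def free_product_def letters_of_reduced)
  show "a \<in> carrier A \<Longrightarrow> ?l (free_product_inl A a) = f a"
    by (auto simp: free_product_inl_def Cons Nil)
  show "b \<in> carrier B \<Longrightarrow> ?l (free_product_inr B b) = g b"
    by (auto simp: free_product_inr_def Cons Nil)
qed

lemma free_product_hom_unique:
  assumes H: "group H"
    and h: "h \<in> hom (free_product A B) H" and k: "k \<in> hom (free_product A B) H"
    and inl: "\<And>a. a \<in> carrier A \<Longrightarrow> h (free_product_inl A a) = k (free_product_inl A a)"
    and inr: "\<And>b. b \<in> carrier B \<Longrightarrow> h (free_product_inr B b) = k (free_product_inr B b)"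
    and w: "w \<in> carrier (free_product A B)"
  shows "h w = k w"
proof -
  let ?G = "free_product A B"
  interpret h: group_hom ?G H h
    using h H group_free_product by (simp add: group_hom_def group_hom_axioms_def)
  interpret k: group_hom ?G H k
    using k H group_free_product by (simp add: group_hom_def group_hom_axioms_def)
  have "reduced_word A B w" using w by (simp add: free_product_def)
  then show ?thesis
  proof (induction w)
    case Nil
    have "[] = \<one>\<^bsub>?G\<^esub>" by (simp add: free_product_def)
    then show ?case by (metis h.hom_one k.hom_one)
  next
    case (Cons x w)
    have "x # w = [x] \<otimes>\<^bsub>?G\<^esub> w"
      using reduced_Cons_reduced[OF Cons.prems] by (simp add: free_product_def)
    moreover have "[x] \<in> carrier ?G" "w \<in> carrier ?G"
      using Cons.prems by (simp_all add: free_product_def reduced_word_Cons)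
    moreover have "h [x] = k [x]"
    proof (cases x)
      case (Inl a)
      with Cons.prems have "a \<in> carrier A" "free_product_inl A a = [x]"
        by (auto simp: reduced_word_Cons free_product_inl_def)
      then show ?thesis using inl[of a] by simp
    next
      case (Inr b)
      with Cons.prems have "b \<in> carrier B" "free_product_inr B b = [x]"
        by (auto simp: reduced_word_Cons free_product_inr_def)
      then show ?thesis using inr[of b] by simp
    qed
    moreover have "h w = k w" using Cons by (simp add: reduced_word_Cons)
    ultimately show ?case by simp
  qed
qed

end

end

theory Submission
  imports Defs "HOL-Algebra.Bij" "HOL-Algebra.Weak_Morphisms" "HOL-Algebra.Elementary_Groups"
begin

text \<open>
  Every element of the free product \<open>G\<close> is conjugate into a factor or to an alternating word
  of even length, and \<open>G\<close> is residually finite, so the interesting case is \<open>u = w ^ r\<close> with \<open>w\<close>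
  alternating and not a proper power as a word. The key tool is a twist of a finite quotient
  \<open>\<phi> : G \<rightarrow> H\<close>, acting on \<open>H \<times> \<int>/L\<close>: crossing a marked point of \<open>H\<close> applies a reflection of
  \<open>\<int>/L\<close>. The points \<open>1\<close> and \<open>\<phi> w ^ m\<close> are marked. If \<open>\<phi>\<close> separates \<open>w\<close> from its proper
  suffixes, then the cycle of \<open>w\<close> crosses each marked point once, so the order of \<open>w\<close> becomes
  divisible by \<open>L\<close>.

  If some power of \<open>w\<close> commutes with a conjugate of \<open>v\<close>, then that conjugate is a power of \<open>w\<close> up
  to inversion, with exponent \<open>i \<noteq> r\<close>, and making the order of \<open>w\<close> divisible by \<open>2 r max(i, 1)\<close>
  suffices. Otherwise, for some \<open>m\<close> and a suitable \<open>\<phi>\<close>, no cycle of \<open>v\<close> crosses both marked points. Then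
  the twist at most doubles the order of \<open>\<phi> v\<close>, while \<open>L\<close> may be as large as we like.
  Both conditions on \<open>\<phi>\<close> only say that certain non-commuting pairs must not commute
  in \<open>H\<close>, hence follow from residual finiteness.
\<close>

section \<open>Finite quotients\<close>

text \<open>Surjectivity is left out on purpose: passing to the image changes neither finiteness nor
  orders, and \<open>order_separable_iff\<close> restores it.\<close>

definition finite_hom :: "('a, 'm) monoid_scheme \<Rightarrow> ('b, 'n) monoid_scheme \<Rightarrow> ('a \<Rightarrow> 'b) \<Rightarrow> bool" where
  "finite_hom G H \<phi> \<longleftrightarrow> group H \<and> finite (carrier H) \<and> \<phi> \<in> hom G H"

definition orders_differ :: "('a, 'm) monoid_scheme \<Rightarrow> 'a \<Rightarrow> 'a \<Rightarrow> bool" where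
  "orders_differ G u v \<longleftrightarrow>
     (\<exists>(H :: nat monoid) \<phi>. finite_hom G H \<phi> \<and> group.ord H (\<phi> u) \<noteq> group.ord H (\<phi> v))"

definition residually_finite :: "('a, 'm) monoid_scheme \<Rightarrow> bool" where
  "residually_finite G \<longleftrightarrow>
     (\<forall>g\<in>carrier G. g \<noteq> \<one>\<^bsub>G\<^esub> \<longrightarrow> (\<exists>(H :: nat monoid) \<phi>. finite_hom G H \<phi> \<and> \<phi> g \<noteq> \<one>\<^bsub>H\<^esub>))"

lemma ord_group_hom_inj:
  assumes "group_hom H K f" "inj_on f (carrier H)" "x \<in> carrier H"
  shows "group.ord K (f x) = group.ord H x"
proof -
  interpret group_hom H K f by fact
  have "f x [^]\<^bsub>K\<^esub> n = \<one>\<^bsub>K\<^esub> \<longleftrightarrow> x [^]\<^bsub>H\<^esub> n = \<one>\<^bsub>H\<^esub>" for n :: nat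
    using assms(2,3) hom_nat_pow[of x n] by (metis G.nat_pow_closed G.one_closed hom_one inj_on_eq_iff)
  then show ?thesis
    using assms(3) by (simp add: H.ord_unique G.pow_eq_id)
qed

lemma finite_hom_group_hom: "group G \<Longrightarrow> finite_hom G H \<phi> \<Longrightarrow> group_hom G H \<phi>"
  by (simp add: finite_hom_def group_hom_def group_hom_axioms_def)

lemma finite_hom_compose: "\<pi> \<in> hom G A \<Longrightarrow> finite_hom A H \<phi> \<Longrightarrow> finite_hom G H (\<phi> \<circ> \<pi>)"
  by (auto simp: finite_hom_def hom_compose)

lemma finite_group_nat_copy:
  assumes "group H" "finite (carrier H)"
  shows "\<exists>(K :: nat monoid) f. finite_hom H K f \<and> inj_on f (carrier H)"
proof -
  obtain f :: "_ \<Rightarrow> nat" where f: "inj_on f (carrier H)"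
    using finite_imp_inj_to_nat_seg[OF assms(2)] by blast
  have iso: "f \<in> iso H (image_group f H)"
    using f by (auto simp: iso_def hom_def bij_betw_def image_group_def)
  have "group (image_group f H)"
    using group.iso_imp_img_group[OF assms(1) iso] by (simp add: image_group_def)
  with iso show ?thesis
    using f assms(2) by (auto simp: finite_hom_def iso_def image_group_carrier)
qed

text \<open>Orders survive an injective homomorphism, so a quotient on any carrier type can be
  copied to the natural numbers by \<open>finite_group_nat_copy\<close>. This lets permutation
  groups serve as quotients later.\<close>

lemma orders_differI:
  fixes H :: "('b, 'n) monoid_scheme"
  assumes "group G" "finite_hom G H \<phi>" "u \<in> carrier G" "v \<in> carrier G"
    and "group.ord H (\<phi> u) \<noteq> group.ord H (\<phi> v)"
  shows "orders_differ G u v"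
proof -
  obtain K :: "nat monoid" and f where f: "finite_hom H K f" "inj_on f (carrier H)"
    using assms(2) finite_group_nat_copy unfolding finite_hom_def by blast
  interpret \<phi>: group_hom G H \<phi> using assms finite_hom_group_hom by blast
  have "group_hom H K f"
    using f(1) finite_hom_group_hom \<phi>.H.group_axioms by blast
  then have "group.ord K (f (\<phi> w)) = group.ord H (\<phi> w)" if "w \<in> carrier G" for w
    using that f(2) by (intro ord_group_hom_inj) auto
  moreover have "finite_hom G K (f \<circ> \<phi>)"
    using finite_hom_compose[OF \<phi>.homh f(1)] .
  ultimately show ?thesis
    using assms unfolding orders_differ_def by (intro exI[of _ K] exI[of _ "f \<circ> \<phi>"]) simp
qed

lemma orders_differ_sym: "orders_differ G u v \<Longrightarrow> orders_differ G v u"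
  unfolding orders_differ_def by metis

section \<open>Conjugacy and orders\<close>

lemma (in group) inv_mult_cancel:
  "\<lbrakk>g \<in> carrier G; x \<in> carrier G\<rbrakk> \<Longrightarrow> inv g \<otimes> (g \<otimes> x) = x"
  by (simp flip: m_assoc)

lemma (in group) mult_inv_cancel:
  "\<lbrakk>g \<in> carrier G; x \<in> carrier G\<rbrakk> \<Longrightarrow> g \<otimes> (inv g \<otimes> x) = x"
  by (simp flip: m_assoc)

lemma (in group) inv_commute:
  assumes "x \<in> carrier G" "y \<in> carrier G" "x \<otimes> y = y \<otimes> x"
  shows "inv x \<otimes> y = y \<otimes> inv x"
proof -
  have "inv x \<otimes> y = inv x \<otimes> (y \<otimes> x) \<otimes> inv x"
    using assms by (simp add: m_assoc)
  also have "\<dots> = y \<otimes> inv x"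
    using assms by (simp add: m_assoc inv_mult_cancel flip: assms(3))
  finally show ?thesis .
qed

lemma (in group) ord_conjugate:
  assumes "g \<in> carrier G" "x \<in> carrier G"
  shows "ord (g \<otimes> x \<otimes> inv g) = ord x"
proof -
  have hom: "group_hom G G (\<lambda>x. g \<otimes> x \<otimes> inv g)"
    using assms(1)
    by unfold_locales (auto simp: hom_def m_assoc inv_mult_cancel)
  have "inj_on (\<lambda>x. g \<otimes> x \<otimes> inv g) (carrier G)"
    using assms(1) by (auto simp: inj_on_def)
  then show ?thesis
    using ord_group_hom_inj[OF hom _ assms(2)] by simp
qed

lemma conjugate_in_sym:
  assumes "group G" "u \<in> carrier G" "conjugate_in G u v"
  shows "conjugate_in G v u"
proof -
  interpret group G by fact
  obtain g where g: "g \<in> carrier G" "v = g \<otimes>\<^bsub>G\<^esub> u \<otimes>\<^bsub>G\<^esub> inv\<^bsub>G\<^esub> g"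
    using assms(3) by (auto simp: conjugate_in_def)
  then have "u = inv\<^bsub>G\<^esub> g \<otimes>\<^bsub>G\<^esub> v \<otimes>\<^bsub>G\<^esub> inv\<^bsub>G\<^esub> (inv\<^bsub>G\<^esub> g)"
    using assms(2) by (simp add: m_assoc inv_mult_cancel)
  then show ?thesis using g(1) unfolding conjugate_in_def by blast
qed

lemma conjugate_in_trans:
  assumes "group G" "u \<in> carrier G" "conjugate_in G u v" "conjugate_in G v w"
  shows "conjugate_in G u w"
proof -
  interpret group G by fact
  obtain g h where g: "g \<in> carrier G" "v = g \<otimes>\<^bsub>G\<^esub> u \<otimes>\<^bsub>G\<^esub> inv\<^bsub>G\<^esub> g"
    and h: "h \<in> carrier G" "w = h \<otimes>\<^bsub>G\<^esub> v \<otimes>\<^bsub>G\<^esub> inv\<^bsub>G\<^esub> h"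
    using assms(3,4) by (auto simp: conjugate_in_def)
  have "w = (h \<otimes>\<^bsub>G\<^esub> g) \<otimes>\<^bsub>G\<^esub> u \<otimes>\<^bsub>G\<^esub> inv\<^bsub>G\<^esub> (h \<otimes>\<^bsub>G\<^esub> g)"
    using g h assms(2) by (simp add: m_assoc inv_mult_group)
  then show ?thesis using g h unfolding conjugate_in_def by blast
qed

lemma conjugate_in_inv:
  assumes "group G" "u \<in> carrier G" "conjugate_in G u v"
  shows "conjugate_in G (inv\<^bsub>G\<^esub> u) (inv\<^bsub>G\<^esub> v)"
proof -
  interpret group G by fact
  obtain g where g: "g \<in> carrier G" "v = g \<otimes>\<^bsub>G\<^esub> u \<otimes>\<^bsub>G\<^esub> inv\<^bsub>G\<^esub> g"
    using assms(3) by (auto simp: conjugate_in_def)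
  then have "inv\<^bsub>G\<^esub> v = g \<otimes>\<^bsub>G\<^esub> inv\<^bsub>G\<^esub> u \<otimes>\<^bsub>G\<^esub> inv\<^bsub>G\<^esub> g"
    using assms(2) by (simp add: m_assoc inv_mult_group)
  then show ?thesis using g(1) unfolding conjugate_in_def by blast
qed

lemma conjugate_in_closed: "group G \<Longrightarrow> u \<in> carrier G \<Longrightarrow> conjugate_in G u v \<Longrightarrow> v \<in> carrier G"
  by (auto simp: conjugate_in_def group.is_monoid group.inv_closed monoid.m_closed)

lemma conjugate_in_hom:
  assumes "group_hom G H h" "u \<in> carrier G" "conjugate_in G u v"
  shows "conjugate_in H (h u) (h v)"
proof -
  interpret group_hom G H h by fact
  show ?thesis using assms(2,3) by (auto simp: conjugate_in_def)
qed

lemma ord_hom_conjugate_in: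
  assumes "group_hom G H h" "u \<in> carrier G" "conjugate_in G u v"
  shows "group.ord H (h v) = group.ord H (h u)"
proof -
  interpret group_hom G H h by fact
  show ?thesis using assms(2,3) by (auto simp: conjugate_in_def H.ord_conjugate)
qed

lemma orders_differ_conjugate_in:
  assumes "group G" "u \<in> carrier G" "v \<in> carrier G" "conjugate_in G u u'" "conjugate_in G v v'"
    and "orders_differ G u' v'"
  shows "orders_differ G u v"
proof -
  obtain H :: "nat monoid" and \<phi> where \<phi>: "finite_hom G H \<phi>"
      and ne: "group.ord H (\<phi> u') \<noteq> group.ord H (\<phi> v')"
    using assms(6) by (auto simp: orders_differ_def)
  have "group_hom G H \<phi>" using assms(1) \<phi> finite_hom_group_hom by blast
  then have "group.ord H (\<phi> u) \<noteq> group.ord H (\<phi> v)"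
    using ne assms ord_hom_conjugate_in[of G H \<phi>] by simp
  then show ?thesis using \<phi> by (auto simp: orders_differ_def)
qed

section \<open>Order separability and residual finiteness via finite quotients\<close>

lemma order_separable_iff:
  assumes "group G"
  shows "order_separable G \<longleftrightarrow>
     (\<forall>u\<in>carrier G. \<forall>v\<in>carrier G. \<not> conjugate_in G u v \<and> \<not> conjugate_in G u (inv\<^bsub>G\<^esub> v) \<longrightarrow>
        orders_differ G u v)"
proof
  assume "order_separable G"
  then show "\<forall>u\<in>carrier G. \<forall>v\<in>carrier G. \<not> conjugate_in G u v \<and> \<not> conjugate_in G u (inv\<^bsub>G\<^esub> v) \<longrightarrow>
        orders_differ G u v"
    unfolding order_separable_def orders_differ_def finite_hom_def epi_def by blast
next
  assume R: "\<forall>u\<in>carrier G. \<forall>v\<in>carrier G. \<not> conjugate_in G u v \<and> \<not> conjugate_in G u (inv\<^bsub>G\<^esub> v) \<longrightarrow>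
        orders_differ G u v"
  show "order_separable G"
  proof (rule order_separableI)
    fix u v
    assume u: "u \<in> carrier G" and v: "v \<in> carrier G"
      and "\<not> conjugate_in G u v" "\<not> conjugate_in G u (inv\<^bsub>G\<^esub> v)"
    then have "orders_differ G u v" using R by blast
    then obtain H :: "nat monoid" and \<phi> where \<phi>: "finite_hom G H \<phi>"
      and ne: "group.ord H (\<phi> u) \<noteq> group.ord H (\<phi> v)"
      by (auto simp: orders_differ_def)
    interpret \<phi>: group_hom G H \<phi> using assms \<phi> finite_hom_group_hom by blast
    \<comment> \<open>Replacing \<open>H\<close> by the image of \<phi> makes the map surjective,
      and the inclusion of the image preserves orders.\<close>
    let ?K = "H\<lparr>carrier := \<phi> ` carrier G\<rparr>"
    have K: "group ?K"
      using \<phi>.img_is_subgroup subgroup.subgroup_is_group \<phi>.H.group_axioms by blast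
    have "group_hom ?K H (\<lambda>x. x)"
      using K by (auto simp: group_hom_def group_hom_axioms_def hom_def \<phi>.H.group_axioms)
    then have "group.ord H (\<phi> w) = group.ord ?K (\<phi> w)" if "w \<in> carrier G" for w
      using that ord_group_hom_inj by fastforce
    moreover have "finite (carrier ?K)"
      using \<phi> by (auto simp: finite_hom_def intro: finite_subset[of _ "carrier H"])
    moreover have "\<phi> \<in> epi G ?K"
      by (auto simp: epi_def hom_def)
    ultimately show "\<exists>(H :: nat monoid) \<phi>. group H \<and> finite (carrier H) \<and> \<phi> \<in> epi G H \<and>
            group.ord H (\<phi> u) \<noteq> group.ord H (\<phi> v)"
      using K ne u v by metis
  qed
qed

text \<open>Only the identity is conjugate to the identity, so orders separate a nontrivial
  \<open>g\<close> from it, and then the image of \<open>g\<close> is nontrivial.\<close>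

lemma residually_finite_if_order_separable:
  assumes "group G" "order_separable G"
  shows "residually_finite G"
  unfolding residually_finite_def
proof (intro ballI impI)
  fix g assume g: "g \<in> carrier G" "g \<noteq> \<one>\<^bsub>G\<^esub>"
  interpret group G by fact
  have "\<not> conjugate_in G g \<one>\<^bsub>G\<^esub>"
  proof
    assume "conjugate_in G g \<one>\<^bsub>G\<^esub>"
    then have "conjugate_in G \<one>\<^bsub>G\<^esub> g" by (rule conjugate_in_sym[OF assms(1) g(1)])
    then obtain h where "h \<in> carrier G" "g = h \<otimes>\<^bsub>G\<^esub> \<one>\<^bsub>G\<^esub> \<otimes>\<^bsub>G\<^esub> inv\<^bsub>G\<^esub> h"
      by (auto simp: conjugate_in_def)
    then show False using g(2) by simp
  qed
  then have "orders_differ G g \<one>\<^bsub>G\<^esub>"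
    using assms g by (auto simp: order_separable_iff)
  then obtain H :: "nat monoid" and \<phi> where \<phi>: "finite_hom G H \<phi>"
      and ne: "group.ord H (\<phi> g) \<noteq> group.ord H (\<phi> \<one>\<^bsub>G\<^esub>)"
    by (auto simp: orders_differ_def)
  interpret \<phi>: group_hom G H \<phi> using assms \<phi> finite_hom_group_hom by blast
  show "\<exists>(H :: nat monoid) \<phi>. finite_hom G H \<phi> \<and> \<phi> g \<noteq> \<one>\<^bsub>H\<^esub>"
    using \<phi> ne by (metis \<phi>.hom_one)
qed

text \<open>The product of a quotient for \<open>S\<close> with one for the new element keeps both
  alive. It lives on pairs, hence the copy \<open>f\<close> to the natural numbers.\<close>

lemma residually_finite_finite_set:
  assumes "group G" "residually_finite G" "finite S" "S \<subseteq> carrier G" "\<one>\<^bsub>G\<^esub> \<notin> S"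
  shows "\<exists>(H :: nat monoid) \<phi>. finite_hom G H \<phi> \<and> (\<forall>g\<in>S. \<phi> g \<noteq> \<one>\<^bsub>H\<^esub>)"
  using assms(3-5)
proof (induction S)
  case empty
  obtain K :: "nat monoid" and f where "finite_hom (singleton_group ()) K f"
    using finite_group_nat_copy[OF singleton_group[of "()"]] unfolding singleton_group_def by auto
  then have "finite_hom G K (\<lambda>_. \<one>\<^bsub>K\<^esub>)" by (auto simp: finite_hom_def hom_def group.is_monoid)
  then show ?case by blast
next
  case (insert g S)
  then obtain H1 :: "nat monoid" and \<phi>1 where 1: "finite_hom G H1 \<phi>1" "\<forall>g\<in>S. \<phi>1 g \<noteq> \<one>\<^bsub>H1\<^esub>"
    by auto
  obtain H2 :: "nat monoid" and \<phi>2 where 2: "finite_hom G H2 \<phi>2" "\<phi>2 g \<noteq> \<one>\<^bsub>H2\<^esub>"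
    using insert.prems assms(2) by (auto simp: residually_finite_def)
  have gr: "group (H1 \<times>\<times> H2)" "finite (carrier (H1 \<times>\<times> H2))"
    using 1 2 by (auto simp: finite_hom_def DirProd_group)
  then obtain K :: "nat monoid" and f where f: "finite_hom (H1 \<times>\<times> H2) K f" "inj_on f (carrier (H1 \<times>\<times> H2))"
    using finite_group_nat_copy by blast
  interpret f: group_hom "H1 \<times>\<times> H2" K f
    using f gr finite_hom_group_hom by blast
  have h: "(\<lambda>x. (\<phi>1 x, \<phi>2 x)) \<in> hom G (H1 \<times>\<times> H2)"
    using 1 2 by (auto simp: finite_hom_def hom_def)
  then have "finite_hom G K (f \<circ> (\<lambda>x. (\<phi>1 x, \<phi>2 x)))"
    using finite_hom_compose f(1) by blast
  moreover have "f (\<phi>1 x, \<phi>2 x) \<noteq> \<one>\<^bsub>K\<^esub>" if "x \<in> insert g S" for x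
  proof -
    have "(\<phi>1 x, \<phi>2 x) \<in> carrier (H1 \<times>\<times> H2)"
      using h insert.prems that by (auto simp: hom_def)
    moreover have "(\<phi>1 x, \<phi>2 x) \<noteq> \<one>\<^bsub>H1 \<times>\<times> H2\<^esub>"
      using 1 2 that by auto
    ultimately show ?thesis
      using f(2) f.G.one_closed by (metis f.hom_one inj_onD)
  qed
  ultimately show ?case by fastforce
qed

section \<open>Finite permutation groups\<close>

lemma action_hom_BijGroup:
  assumes "group G"
    and closed: "\<And>g x. g \<in> carrier G \<Longrightarrow> x \<in> X \<Longrightarrow> act g x \<in> X"
    and one: "\<And>x. x \<in> X \<Longrightarrow> act \<one>\<^bsub>G\<^esub> x = x"
    and mult: "\<And>g h x. \<lbrakk>g \<in> carrier G; h \<in> carrier G; x \<in> X\<rbrakk> \<Longrightarrow> act (g \<otimes>\<^bsub>G\<^esub> h) x = act g (act h x)"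
  shows "(\<lambda>g. restrict (act g) X) \<in> hom G (BijGroup X)"
proof -
  interpret group G by fact
  have bij: "restrict (act g) X \<in> Bij X" if g: "g \<in> carrier G" for g
  proof -
    have "bij_betw (act g) X X"
      by (rule bij_betw_byWitness[where f' = "act (inv\<^bsub>G\<^esub> g)"])
        (use g in \<open>auto simp: closed one simp flip: mult\<close>)
    then show ?thesis
      by (simp add: Bij_def bij_betw_restrict_eq)
  qed
  then show ?thesis
    by (auto simp: hom_def BijGroup_def compose_def closed mult restrict_def fun_eq_iff)
qed

lemma finite_BijGroup: "finite X \<Longrightarrow> finite (carrier (BijGroup X))"
proof (rule finite_subset)
  show "carrier (BijGroup X) \<subseteq> X \<rightarrow>\<^sub>E X"
    using Bij_imp_funcset Bij_imp_extensional by (force simp: BijGroup_def PiE_def)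
qed (simp add: finite_PiE)


section \<open>Commuting words\<close>

lemma concat_replicate_concat_replicate:
  "concat (replicate m (concat (replicate n xs))) = concat (replicate (n * m) xs)"
  by (induction m) (auto simp: replicate_add)

lemma concat_replicate_commute:
  "xs @ concat (replicate n xs) = concat (replicate n xs) @ xs"
  by (induction n) auto

lemma append_commute_replicate:
  "xs @ ys = ys @ xs \<Longrightarrow> xs @ concat (replicate n ys) = concat (replicate n ys) @ xs"
proof (induction n)
  case (Suc n)
  have "xs @ ys @ concat (replicate n ys) = ys @ xs @ concat (replicate n ys)"
    using Suc.prems by (metis append_assoc)
  then show ?case using Suc by simp
qed simp

text \<open>Commuting with \<open>zs\<close> implies commuting with its powers, so \<open>xs\<close>
  begins any power of \<open>zs\<close> that is at least as long.\<close>

lemma prefix_of_power_if_append_commute: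
  assumes "xs @ zs = zs @ xs" "zs \<noteq> []" "length xs \<le> length (concat (replicate n zs))"
  shows "take (length xs) (concat (replicate n zs)) = xs"
proof -
  have "xs @ concat (replicate n zs) = concat (replicate n zs) @ xs"
    using assms(1) by (rule append_commute_replicate)
  then have "take (length xs) (concat (replicate n zs) @ xs) = xs"
    by (metis append_eq_conv_conj)
  then show ?thesis using assms(3) by simp
qed

text \<open>Both \<open>xs @ ys\<close> and \<open>ys @ xs\<close> commute with \<open>zs\<close>,
  so both are prefixes of the same length of one power of \<open>zs\<close>.\<close>

lemma append_commute_trans:
  assumes "xs @ zs = zs @ xs" "ys @ zs = zs @ ys" "zs \<noteq> []"
  shows "xs @ ys = ys @ xs"
proof -
  define n where "n = length (xs @ ys)"
  have "length (concat (replicate n zs)) = n * length zs"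
    by (induction n) auto
  then have n: "length (xs @ ys) \<le> length (concat (replicate n zs))"
    using assms(3) by (cases zs) (simp_all add: n_def)
  have "(xs @ ys) @ zs = zs @ xs @ ys" "(ys @ xs) @ zs = zs @ ys @ xs"
    using assms(1,2) by (metis append_assoc)+
  then have "take (length (xs @ ys)) (concat (replicate n zs)) = xs @ ys"
    and "take (length (ys @ xs)) (concat (replicate n zs)) = ys @ xs"
    using n assms(3) prefix_of_power_if_append_commute[of "xs @ ys" zs n]
      prefix_of_power_if_append_commute[of "ys @ xs" zs n] by (simp_all add: add.commute)
  then show ?thesis by (metis add.commute length_append)
qed

text \<open>The primitive words of combinatorics on words; powers are meant for concatenation, not
  for the group product.\<close>

definition primitive_list :: "'a list \<Rightarrow> bool" where
  "primitive_list w \<longleftrightarrow> w \<noteq> [] \<and> (\<forall>z k. w = concat (replicate k z) \<longrightarrow> k = 1)"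

text \<open>A root \<open>w\<close> of least length works: if \<open>w\<close> is a power of
  \<open>z\<close>, then \<open>z\<close> is again a root of \<open>u\<close> and not shorter than
  \<open>w\<close>, which forces exponent 1.\<close>

lemma primitive_root_exists:
  assumes "u \<noteq> []"
  obtains w r where "primitive_list w" "0 < r" "u = concat (replicate r w)"
proof -
  let ?P = "\<lambda>w. \<exists>r. u = concat (replicate r w)"
  have "?P u" by (intro exI[of _ 1]) simp
  then obtain w where w: "?P w" and min: "\<And>z. ?P z \<Longrightarrow> length w \<le> length z"
    using ex_has_least_nat[of ?P u length] by blast
  then obtain r where r: "u = concat (replicate r w)" by blast
  have ne: "w \<noteq> []" "0 < r" using assms r by (auto intro: gr0I)
  have "k = 1" if k: "w = concat (replicate k z)" for z k
  proof -
    have "?P z" using r k concat_replicate_concat_replicate by metis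
    then have "length w \<le> length z" by (rule min)
    moreover have "length w = k * length z" unfolding k by (induction k) auto
    moreover have "0 < length w" using ne by simp
    ultimately show ?thesis by (cases k rule: nat.exhaust; cases "k - 1"; auto)
  qed
  then show ?thesis using that[of w r] ne r by (simp add: primitive_list_def)
qed

lemma primitive_list_commute:
  assumes "primitive_list w" "xs @ w = w @ xs"
  obtains i where "xs = concat (replicate i w)"
proof -
  obtain m n zs where *: "concat (replicate m zs) = xs" "concat (replicate n zs) = w"
    using comm_append_are_replicate[OF assms(2)] by blast
  then have "n = 1" using assms(1) by (metis primitive_list_def)
  then show ?thesis using * that by auto
qed

section \<open>Reduced words and centralizers in the free product\<close>

context two_groups
begin

abbreviation G where "G \<equiv> free_product A B"

sublocale G: group G
  by (rule group_free_product)

lemma carrier_G [simp]: "w \<in> carrier G \<longleftrightarrow> reduced_word A B w"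
  by (simp add: free_product_def)

lemma one_G: "\<one>\<^bsub>G\<^esub> = []"
  by (simp add: free_product_def)

lemma mult_G: "u \<otimes>\<^bsub>G\<^esub> v = foldr (reduced_Cons A B) u v"
  by (simp add: free_product_def)

lemma reduced_word_append:
  "reduced_word A B (u @ v) \<longleftrightarrow>
     reduced_word A B u \<and> reduced_word A B v \<and> (u = [] \<or> v = [] \<or> isl (last u) \<noteq> isl (hd v))"
  by (auto simp: reduced_word_def successively_append_iff)

lemma mult_eq_append:
  assumes "reduced_word A B (u @ v)"
  shows "u \<otimes>\<^bsub>G\<^esub> v = u @ v"
  using assms
proof (induction u)
  case (Cons x u)
  then have "reduced_word A B (u @ v)" by (simp add: reduced_word_Cons)
  with Cons show ?case
    using reduced_Cons_reduced[of x "u @ v"] by (simp add: mult_G)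
qed (simp add: mult_G)

lemma length_reduced_Cons: "length (reduced_Cons A B x w) \<le> Suc (length w)"
  by (cases "(A, B, x, w)" rule: reduced_Cons.cases) auto

lemma length_reduced_Cons_merge:
  "w \<noteq> [] \<Longrightarrow> isl x = isl (hd w) \<Longrightarrow> length (reduced_Cons A B x w) \<le> length w"
  by (cases "(A, B, x, w)" rule: reduced_Cons.cases) auto

lemma length_mult: "length (u \<otimes>\<^bsub>G\<^esub> v) \<le> length u + length v"
proof (induction u)
  case (Cons x u)
  then show ?case
    using length_reduced_Cons[of x "u \<otimes>\<^bsub>G\<^esub> v"] by (simp add: mult_G)
qed (simp add: mult_G)

text \<open>Letters of the same factor at the seam merge or cancel, which costs at least one
  letter.\<close>

lemma length_mult_merge:
  assumes "u \<noteq> []" "v \<noteq> []" "isl (last u) = isl (hd v)"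
  shows "length (u \<otimes>\<^bsub>G\<^esub> v) < length u + length v"
proof -
  obtain u' x where u: "u = u' @ [x]" using assms(1) by (metis rev_exhaust)
  have "u \<otimes>\<^bsub>G\<^esub> v = u' \<otimes>\<^bsub>G\<^esub> reduced_Cons A B x v" by (simp add: u mult_G)
  moreover have "length (reduced_Cons A B x v) \<le> length v"
    using assms u by (intro length_reduced_Cons_merge) auto
  ultimately show ?thesis using length_mult[of u' "reduced_Cons A B x v"] by (simp add: u)
qed

text \<open>If no cancellation occurs in \<open>x \<cdot> y\<close>, then lengths rule out cancellation in \<open>y \<cdot> x\<close> too.\<close>

lemma commute_imp_append_commute:
  assumes "reduced_word A B x" "reduced_word A B y" "x \<noteq> []" "y \<noteq> []"
    and "isl (last x) \<noteq> isl (hd y)" "x \<otimes>\<^bsub>G\<^esub> y = y \<otimes>\<^bsub>G\<^esub> x"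
  shows "x @ y = y @ x"
proof -
  have xy: "x \<otimes>\<^bsub>G\<^esub> y = x @ y"
    using assms by (intro mult_eq_append) (simp add: reduced_word_append)
  then have "length (y \<otimes>\<^bsub>G\<^esub> x) = length y + length x" using assms(6) by simp
  then have "isl (last y) \<noteq> isl (hd x)"
    using length_mult_merge[OF assms(4,3)] by linarith
  then have "y \<otimes>\<^bsub>G\<^esub> x = y @ x"
    using assms by (intro mult_eq_append) (simp add: reduced_word_append)
  then show ?thesis using xy assms(6) by simp
qed

text \<open>Such a word is cyclically reduced, since its end and its beginning lie in different
  factors; hence its powers are plain repetitions of the list. Starting in \<open>A\<close> is a
  normalization up to conjugacy.\<close>

definition alternating :: "('a + 'b) list \<Rightarrow> bool" where
  "alternating w \<longleftrightarrow> reduced_word A B w \<and> w \<noteq> [] \<and> isl (hd w) \<and> \<not> isl (last w)"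

lemma alternating_root:
  assumes "alternating (concat (replicate r w))"
  shows "alternating w"
proof -
  obtain k where k: "r = Suc k" using assms by (cases r) (auto simp: alternating_def)
  then have eq: "concat (replicate r w) = w @ concat (replicate k w)"
     "concat (replicate r w) = concat (replicate k w) @ w"
    by (simp_all add: concat_replicate_commute)
  have "w \<noteq> []" using assms by (cases "w = []") (auto simp: alternating_def)
  then show ?thesis using assms eq
    unfolding alternating_def by (metis hd_append2 last_appendR reduced_word_append)
qed

lemma alternating_pow:
  assumes "alternating w"
  shows "w [^]\<^bsub>G\<^esub> n = concat (replicate n w) \<and> reduced_word A B (concat (replicate n w))"
proof (induction n)
  case (Suc n)
  have "reduced_word A B (concat (replicate n w) @ w)"
  proof (cases n)
    case (Suc k)
    then have "concat (replicate n w) = concat (replicate k w) @ w"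
      by (simp add: concat_replicate_commute)
    then have "concat (replicate n w) \<noteq> []" "last (concat (replicate n w)) = last w"
      using assms by (auto simp: alternating_def)
    then show ?thesis
      using Suc.IH assms unfolding reduced_word_append by (simp add: alternating_def)
  qed (use assms in \<open>simp add: alternating_def\<close>)
  then show ?case
    using Suc mult_eq_append by (simp add: concat_replicate_commute)
qed (simp add: one_G)

lemma pow_alternating_suc:
  assumes "alternating w"
  shows "alternating (w [^]\<^bsub>G\<^esub> Suc n)"
proof -
  have "w [^]\<^bsub>G\<^esub> Suc n = w @ concat (replicate n w)" "w [^]\<^bsub>G\<^esub> Suc n = concat (replicate n w) @ w"
    using alternating_pow[OF assms, of "Suc n"] by (simp_all add: concat_replicate_commute)
  then show ?thesis
    using alternating_pow[OF assms, of "Suc n"] assms unfolding alternating_def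
    by (metis append_is_Nil_conv hd_append2 last_appendR)
qed

text \<open>A suffix of \<open>w\<close> ends in \<open>B\<close> while \<open>w\<close> begins in
  \<open>A\<close>, so commuting in the group would mean commuting as words. Then \<open>s\<close>
  would be a power of the primitive \<open>w\<close>, although it is nonempty and shorter.\<close>

lemma suffix_not_commute:
  assumes "alternating w" "primitive_list w" "w = s' @ s" "s \<noteq> []" "s' \<noteq> []"
  shows "s \<otimes>\<^bsub>G\<^esub> w \<noteq> w \<otimes>\<^bsub>G\<^esub> s"
proof
  assume "s \<otimes>\<^bsub>G\<^esub> w = w \<otimes>\<^bsub>G\<^esub> s"
  moreover have "reduced_word A B s" "isl (last s) \<noteq> isl (hd w)"
    using assms by (auto simp: alternating_def reduced_word_append)
  ultimately have "s @ w = w @ s"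
    using assms by (intro commute_imp_append_commute) (auto simp: alternating_def)
  then obtain i where i: "s = concat (replicate i w)"
    using primitive_list_commute[OF assms(2)] by blast
  have "i \<noteq> 0" using i assms(4) by (cases i) auto
  then obtain k where "i = Suc k" using not0_implies_Suc by blast
  then have "length w \<le> length s" using i by simp
  then show False using assms(3,5) by simp
qed

text \<open>The condition on the last letter makes \<open>x\<close> commute with the power of
  \<open>w\<close> as a word. So does \<open>w\<close>, and \<open>append_commute_trans\<close>
  gives that \<open>x\<close> commutes with \<open>w\<close> itself.\<close>

lemma centralizer_aux:
  assumes w: "alternating w" "primitive_list w" and n: "0 < (n :: nat)"
    and x: "reduced_word A B x" "x \<noteq> []" "\<not> isl (last x)"
    and comm: "x \<otimes>\<^bsub>G\<^esub> w [^]\<^bsub>G\<^esub> n = w [^]\<^bsub>G\<^esub> n \<otimes>\<^bsub>G\<^esub> x"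
  shows "\<exists>i::nat. x = w [^]\<^bsub>G\<^esub> i"
proof -
  let ?W = "w [^]\<^bsub>G\<^esub> n"
  have W: "alternating ?W" using pow_alternating_suc[OF w(1), of "n - 1"] n by simp
  have xW: "x @ ?W = ?W @ x"
    using x W comm by (intro commute_imp_append_commute) (auto simp: alternating_def)
  have "w @ ?W = ?W @ w"
    using alternating_pow[OF w(1)] by (simp add: concat_replicate_commute)
  with xW have "x @ w = w @ x"
    using append_commute_trans[of x ?W w] W by (auto simp: alternating_def)
  then show ?thesis
    using primitive_list_commute[OF w(2)] alternating_pow[OF w(1)] by metis
qed

text \<open>\<open>centralizer_aux\<close> covers words ending in \<open>B\<close>. If
  \<open>x\<close> ends in \<open>A\<close>, then its inverse turns out to end in \<open>B\<close>,
  and it commutes with the same power of \<open>w\<close>.\<close>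

lemma centralizer_alternating:
  assumes w: "alternating w" "primitive_list w" and n: "0 < (n :: nat)"
    and x: "x \<in> carrier G"
    and comm: "x \<otimes>\<^bsub>G\<^esub> w [^]\<^bsub>G\<^esub> n = w [^]\<^bsub>G\<^esub> n \<otimes>\<^bsub>G\<^esub> x"
  shows "\<exists>i::nat. x = w [^]\<^bsub>G\<^esub> i \<or> inv\<^bsub>G\<^esub> x = w [^]\<^bsub>G\<^esub> i"
proof (cases "x = []")
  case True
  then show ?thesis by (intro exI[of _ 0]) (simp add: one_G)
next
  case x_ne: False
  let ?W = "w [^]\<^bsub>G\<^esub> n"
  have W: "alternating ?W" using pow_alternating_suc[OF w(1), of "n - 1"] n by simp
  have Wc: "?W \<in> carrier G" using W by (simp add: alternating_def)
  show ?thesis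
  proof (cases "isl (last x)")
    case False
    then show ?thesis using centralizer_aux[OF w n _ x_ne False comm] x by auto
  next
    case True
    let ?V = "inv\<^bsub>G\<^esub> ?W"
    \<comment> \<open>A product of nontrivial words that equals the identity cannot be a mere
      concatenation, so the letters at the seam lie in one factor.\<close>
    have cancel: "isl (last y) = isl (hd z)"
      if "y \<in> carrier G" "y \<noteq> []" "z \<noteq> []" "z \<in> carrier G" "y \<otimes>\<^bsub>G\<^esub> z = \<one>\<^bsub>G\<^esub>" for y z
      using that mult_eq_append[of y z] by (auto simp: reduced_word_append one_G)
    have V: "?V \<in> carrier G" "?V \<noteq> []"
      using Wc W by (auto simp: alternating_def simp flip: one_G simp del: carrier_G)
    have "isl (last ?W) = isl (hd ?V)"
      using Wc V W by (intro cancel) (auto simp: alternating_def simp del: carrier_G)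
    then have hdV: "\<not> isl (hd ?V)" using W by (simp add: alternating_def)
    have "x \<otimes>\<^bsub>G\<^esub> ?V = ?V \<otimes>\<^bsub>G\<^esub> x"
      using G.inv_commute[OF Wc x] comm by simp
    \<comment> \<open>\<open>x\<close> ends in \<open>A\<close> and \<open>?V\<close> begins in
      \<open>B\<close>, so they commute as words; hence \<open>x\<close> begins in \<open>B\<close>
      as well.\<close>
    then have "x @ ?V = ?V @ x"
      using x V x_ne True hdV by (intro commute_imp_append_commute) auto
    then have hdx: "\<not> isl (hd x)" using hdV V x_ne by (metis hd_append2)
    have ix: "inv\<^bsub>G\<^esub> x \<in> carrier G" "inv\<^bsub>G\<^esub> x \<noteq> []"
      using x x_ne by (auto simp flip: one_G simp del: carrier_G)
    have "isl (last (inv\<^bsub>G\<^esub> x)) = isl (hd x)"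
      using x ix x_ne by (intro cancel) (auto simp del: carrier_G)
    then have "\<not> isl (last (inv\<^bsub>G\<^esub> x))" using hdx by simp
    moreover have "inv\<^bsub>G\<^esub> x \<otimes>\<^bsub>G\<^esub> ?W = ?W \<otimes>\<^bsub>G\<^esub> inv\<^bsub>G\<^esub> x"
      using G.inv_commute[OF x Wc comm] .
    ultimately show ?thesis
      using centralizer_aux[OF w n _ ix(2)] ix(1) by auto
  qed
qed

lemma inl_closed [simp]: "a \<in> carrier A \<Longrightarrow> reduced_word A B (free_product_inl A a)"
  and inr_closed [simp]: "b \<in> carrier B \<Longrightarrow> reduced_word A B (free_product_inr B b)"
  by (auto simp: free_product_inl_def free_product_inr_def reduced_word_Cons)

text \<open>Moving the first letter to the end is a conjugation. It either shortens the word, so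
  that induction on the length applies, or shows that the word is cyclically reduced
  already.\<close>

lemma conjugate_cyclically_reduced:
  assumes "g \<in> carrier G"
  shows "\<exists>g'. conjugate_in G g g' \<and>
    ((\<exists>a\<in>carrier A. g' = free_product_inl A a) \<or> (\<exists>b\<in>carrier B. g' = free_product_inr B b) \<or> alternating g')"
  using assms
proof (induction "length g" arbitrary: g rule: less_induct)
  case less
  have refl: "conjugate_in G h h" if "h \<in> carrier G" for h
    using that G.one_closed unfolding conjugate_in_def
    by (intro bexI[of _ "\<one>\<^bsub>G\<^esub>"]) (simp_all del: carrier_G)
  consider "g = []" | x where "g = [x]" | x w where "g = x # w" "w \<noteq> []"
    by (cases g; cases "tl g") auto
  then show ?case
  proof cases
    case 1
    then show ?thesis using less.prems refl
      by (intro exI[of _ g] conjI disjI1) (auto simp: free_product_inl_def intro!: bexI[of _ "\<one>\<^bsub>A\<^esub>"])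
  next
    case (2 x)
    then show ?thesis using less.prems refl[OF less.prems]
      by (intro exI[of _ g]; cases x)
        (auto simp: free_product_inl_def free_product_inr_def reduced_word_Cons)
  next
    case (3 x w)
    have r: "reduced_word A B [x]" "reduced_word A B w" "isl x \<noteq> isl (hd w)"
      using less.prems 3 by (auto simp: reduced_word_Cons)
    have g: "g = [x] \<otimes>\<^bsub>G\<^esub> w" using 3 less.prems mult_eq_append[of "[x]" w] by simp
    have "w \<otimes>\<^bsub>G\<^esub> [x] = inv\<^bsub>G\<^esub> [x] \<otimes>\<^bsub>G\<^esub> g \<otimes>\<^bsub>G\<^esub> inv\<^bsub>G\<^esub> (inv\<^bsub>G\<^esub> [x])"
      using r g by (simp add: G.m_assoc G.inv_mult_cancel flip: carrier_G)
    then have conj: "conjugate_in G g (w \<otimes>\<^bsub>G\<^esub> [x])"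
      using r unfolding conjugate_in_def by (metis G.inv_closed carrier_G)
    show ?thesis
    proof (cases "isl (last w) = isl x")
      case True
      then have "length (w \<otimes>\<^bsub>G\<^esub> [x]) < length g"
        using length_mult_merge[of w "[x]"] 3 by simp
      moreover have "w \<otimes>\<^bsub>G\<^esub> [x] \<in> carrier G" using r by (simp flip: carrier_G)
      ultimately show ?thesis
        using less.hyps conj conjugate_in_trans[OF G.group_axioms less.prems] by blast
    next
      case False
      then have wx: "w \<otimes>\<^bsub>G\<^esub> [x] = w @ [x]" "reduced_word A B (w @ [x])"
        using r mult_eq_append[of w "[x]"] by (auto simp: reduced_word_append)
      \<comment> \<open>The two ends of \<open>g\<close> lie in different factors, so either
        \<open>g\<close> or its rotation begins in \<open>A\<close>.\<close>
      show ?thesis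
      proof (cases "isl x")
        case True
        then have "alternating g" using 3 less.prems False by (simp add: alternating_def)
        then show ?thesis using refl[OF less.prems] by blast
      next
        case F: False
        then have "alternating (w @ [x])" using wx r 3 by (simp add: alternating_def)
        then show ?thesis using conj wx by auto
      qed
    qed
  qed
qed

end


section \<open>Residual finiteness\<close>

lemma BijGroup_mult_apply:
  "\<lbrakk>f \<in> carrier (BijGroup X); g \<in> carrier (BijGroup X); p \<in> X\<rbrakk> \<Longrightarrow> (f \<otimes>\<^bsub>BijGroup X\<^esub> g) p = f (g p)"
  by (simp add: BijGroup_def compose_def)

lemma BijGroup_one_apply: "p \<in> X \<Longrightarrow> \<one>\<^bsub>BijGroup X\<^esub> p = p"
  by (simp add: BijGroup_def)

lemma BijGroup_closed: "f \<in> carrier (BijGroup X) \<Longrightarrow> p \<in> X \<Longrightarrow> f p \<in> X"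
  using Bij_imp_funcset by (fastforce simp: BijGroup_def)

lemma BijGroup_pow_Suc_apply:
  assumes "f \<in> carrier (BijGroup X)" "p \<in> X"
  shows "(f [^]\<^bsub>BijGroup X\<^esub> Suc n) p = f ((f [^]\<^bsub>BijGroup X\<^esub> n) p)"
proof -
  interpret group "BijGroup X" by (rule group_BijGroup)
  show ?thesis
    using assms nat_pow_Suc2[of f n] BijGroup_mult_apply by (metis nat_pow_closed)
qed

lemma BijGroup_eq_oneI:
  assumes "f \<in> carrier (BijGroup X)" "\<And>p. p \<in> X \<Longrightarrow> f p = p"
  shows "f = \<one>\<^bsub>BijGroup X\<^esub>"
  using assms by (auto simp: BijGroup_def Bij_def extensional_def fun_eq_iff)

context two_groups
begin

lemma free_product_lift_BijGroup_Nil: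
  "p \<in> X \<Longrightarrow> free_product_lift (BijGroup X) f g [] p = p"
  by (simp add: free_product_lift_def BijGroup_one_apply)

lemma free_product_lift_BijGroup_Cons:
  assumes "f \<in> hom A (BijGroup X)" "g \<in> hom B (BijGroup X)" "reduced_word A B (x # w)" "p \<in> X"
  shows "free_product_lift (BijGroup X) f g (x # w) p =
    case_sum f g x (free_product_lift (BijGroup X) f g w p)"
proof -
  have "w \<in> carrier G" using assms(3) by (simp add: reduced_word_Cons)
  then have "free_product_lift (BijGroup X) f g w \<in> carrier (BijGroup X)"
    using free_product_lift(1)[OF group_BijGroup assms(1,2)] by (auto simp: hom_def)
  moreover have "case_sum f g x \<in> carrier (BijGroup X)"
    using assms by (auto simp: hom_def reduced_word_Cons)
  moreover have "free_product_lift (BijGroup X) f g (x # w) =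
      case_sum f g x \<otimes>\<^bsub>BijGroup X\<^esub> free_product_lift (BijGroup X) f g w"
    by (simp add: free_product_lift_def)
  ultimately show ?thesis
    using assms(4) by (simp add: BijGroup_mult_apply)
qed

text \<open>
  A letter acts on the words of length at most \<open>n\<close> as in the free product, except that it fixes
  the words that would become too long.
\<close>

definition ball_act :: "nat \<Rightarrow> 'a + 'b \<Rightarrow> ('a + 'b) list \<Rightarrow> ('a + 'b) list" where
  "ball_act n x w = (if length w = n \<and> isl (hd w) \<noteq> isl x then w else reduced_Cons A B x w)"

definition ball :: "nat \<Rightarrow> ('a + 'b) list set" where
  "ball n = {w. reduced_word A B w \<and> length w \<le> n}"

lemma finite_ball:
  assumes "finite (carrier A)" "finite (carrier B)"
  shows "finite (ball n)"
proof (rule finite_subset)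
  show "ball n \<subseteq> {w. set w \<subseteq> letters \<and> length w \<le> n}"
    using letters_of_reduced by (auto simp: ball_def)
qed (use assms in \<open>simp add: finite_lists_length_le\<close>)

lemma ball_act_closed:
  assumes "0 < n" "x \<in> letters" "w \<in> ball n"
  shows "ball_act n x w \<in> ball n"
proof -
  have "length (reduced_Cons A B x w) \<le> n" if "length w = n \<longrightarrow> isl (hd w) = isl x"
  proof (cases "length w = n")
    case True
    then show ?thesis using that assms(1) length_reduced_Cons_merge[of w x] by auto
  next
    case False
    then show ?thesis using assms(3) length_reduced_Cons[of x w] by (simp add: ball_def)
  qed
  then show ?thesis
    using assms by (auto simp: ball_act_def ball_def reduced_Cons_closed)
qed

lemma ball_act_one:
  "w \<in> ball n \<Longrightarrow> ball_act n (Inl \<one>\<^bsub>A\<^esub>) w = w" "w \<in> ball n \<Longrightarrow> ball_act n (Inr \<one>\<^bsub>B\<^esub>) w = w"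
  by (auto simp: ball_act_def ball_def reduced_Cons_one)

text \<open>Which words are fixed for being too long depends only on the factor of \<open>x\<close>.
  Multiplication by letters of that factor preserves the remaining words, so the truncation is still
  an action of each factor.\<close>

lemma not_fixed_reduced_Cons:
  assumes "0 < n" "w \<in> ball n" "\<not> (length w = n \<and> isl (hd w) \<noteq> isl x)"
  shows "\<not> (length (reduced_Cons A B x w) = n \<and> isl (hd (reduced_Cons A B x w)) \<noteq> isl x)"
  using assms
  by (cases "(A, B, x, w)" rule: reduced_Cons.cases) (auto simp: ball_def)

lemma ball_act_hom:
  assumes "0 < n"
  shows "(\<lambda>a. restrict (ball_act n (Inl a)) (ball n)) \<in> hom A (BijGroup (ball n))"
    and "(\<lambda>b. restrict (ball_act n (Inr b)) (ball n)) \<in> hom B (BijGroup (ball n))"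
proof -
  show "(\<lambda>a. restrict (ball_act n (Inl a)) (ball n)) \<in> hom A (BijGroup (ball n))"
  proof (rule action_hom_BijGroup[OF A.group_axioms])
    fix g h x assume "g \<in> carrier A" "h \<in> carrier A" "x \<in> ball n"
    then show "ball_act n (Inl (g \<otimes>\<^bsub>A\<^esub> h)) x = ball_act n (Inl g) (ball_act n (Inl h) x)"
      using not_fixed_reduced_Cons[OF assms, of x "Inl h"] reduced_Cons_Inl_mult[of g h x]
      unfolding ball_act_def ball_def by auto
  qed (use assms in \<open>auto simp: ball_act_one intro!: ball_act_closed\<close>)
  show "(\<lambda>b. restrict (ball_act n (Inr b)) (ball n)) \<in> hom B (BijGroup (ball n))"
  proof (rule action_hom_BijGroup[OF B.group_axioms])
    fix g h x assume "g \<in> carrier B" "h \<in> carrier B" "x \<in> ball n"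
    then show "ball_act n (Inr (g \<otimes>\<^bsub>B\<^esub> h)) x = ball_act n (Inr g) (ball_act n (Inr h) x)"
      using not_fixed_reduced_Cons[OF assms, of x "Inr h"] reduced_Cons_Inr_mult[of g h x]
      unfolding ball_act_def ball_def by auto
  qed (use assms in \<open>auto simp: ball_act_one intro!: ball_act_closed\<close>)
qed

end

lemma reduced_word_map_sum:
  assumes "\<phi> \<in> hom A H" "\<chi> \<in> hom B K" "reduced_word A B w"
    and "\<forall>a. Inl a \<in> set w \<longrightarrow> \<phi> a \<noteq> \<one>\<^bsub>H\<^esub>" "\<forall>b. Inr b \<in> set w \<longrightarrow> \<chi> b \<noteq> \<one>\<^bsub>K\<^esub>"
  shows "reduced_word H K (map (map_sum \<phi> \<chi>) w)"
  using assms(3-5)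
proof (induction w)
  case (Cons x w)
  have "map (map_sum \<phi> \<chi>) w = [] \<or> isl (map_sum \<phi> \<chi> x) \<noteq> isl (hd (map (map_sum \<phi> \<chi>) w))"
    using Cons.prems by (cases w) (auto simp: reduced_word_Cons isl_map_sum)
  moreover have "map_sum \<phi> \<chi> x \<in> (carrier H - {\<one>\<^bsub>H\<^esub>}) <+> (carrier K - {\<one>\<^bsub>K\<^esub>})"
    using Cons.prems assms(1,2) by (auto simp: reduced_word_Cons hom_def)
  ultimately show ?case
    using Cons by (simp add: reduced_word_Cons)
qed simp

context two_groups
begin

text \<open>First \<open>A\<close> and \<open>B\<close> are replaced by finite quotients
  \<open>H\<close> and \<open>K\<close> in which no letter of \<open>g\<close> dies. Then
  \<open>g\<close> acts on a ball of radius \<open>length g\<close> in the free product of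
  \<open>H\<close> and \<open>K\<close> and sends the empty word to the image word of
  \<open>g\<close>, which is nonempty.\<close>

lemma residually_finite_free_product:
  assumes "residually_finite A" "residually_finite B"
  shows "residually_finite G"
  unfolding residually_finite_def
proof (intro ballI impI)
  fix g assume g: "g \<in> carrier G" "g \<noteq> \<one>\<^bsub>G\<^esub>"
  define n where "n = length g"
  have n: "0 < n" using g by (simp add: n_def one_G)
  have finA: "finite (Inl -` set g)" "Inl -` set g \<subseteq> carrier A" "\<one>\<^bsub>A\<^esub> \<notin> Inl -` set g"
    using g(1) by (auto simp: reduced_word_def intro: finite_vimageI)
  obtain H :: "nat monoid" and \<phi> where \<phi>: "finite_hom A H \<phi>" "\<forall>a\<in>Inl -` set g. \<phi> a \<noteq> \<one>\<^bsub>H\<^esub>"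
    using residually_finite_finite_set[OF A.group_axioms assms(1) finA] by blast
  have finB: "finite (Inr -` set g)" "Inr -` set g \<subseteq> carrier B" "\<one>\<^bsub>B\<^esub> \<notin> Inr -` set g"
    using g(1) by (auto simp: reduced_word_def intro: finite_vimageI)
  obtain K :: "nat monoid" and \<chi> where \<chi>: "finite_hom B K \<chi>" "\<forall>b\<in>Inr -` set g. \<chi> b \<noteq> \<one>\<^bsub>K\<^esub>"
    using residually_finite_finite_set[OF B.group_axioms assms(2) finB] by blast
  interpret HK: two_groups H K
    using \<phi>(1) \<chi>(1) by (simp add: two_groups_def finite_hom_def)
  let ?X = "HK.ball n"
  define f where "f = (\<lambda>h. restrict (HK.ball_act n (Inl h)) ?X) \<circ> \<phi>"
  define k where "k = (\<lambda>h. restrict (HK.ball_act n (Inr h)) ?X) \<circ> \<chi>"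
  define \<psi> where "\<psi> = free_product_lift (BijGroup ?X) f k"
  have f: "f \<in> hom A (BijGroup ?X)"
    unfolding f_def using \<phi>(1) HK.ball_act_hom(1)[OF n] by (auto simp: finite_hom_def intro: hom_compose)
  have k: "k \<in> hom B (BijGroup ?X)"
    unfolding k_def using \<chi>(1) HK.ball_act_hom(2)[OF n] by (auto simp: finite_hom_def intro: hom_compose)
  have hom: "finite_hom G (BijGroup ?X) \<psi>"
    using free_product_lift(1)[OF group_BijGroup f k] \<phi>(1) \<chi>(1)
    by (simp add: finite_hom_def \<psi>_def group_BijGroup finite_BijGroup HK.finite_ball)
  have nil: "[] \<in> ?X" by (simp add: HK.ball_def)
  \<comment> \<open>The image word is written letter by letter from the right. Before each letter
    the length is below \<open>n\<close>, so truncation does not interfere.\<close>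
  have "\<psi> t [] = map (map_sum \<phi> \<chi>) t \<and> reduced_word H K (map (map_sum \<phi> \<chi>) t)"
    if "length t \<le> n" "reduced_word A B t" "set t \<subseteq> set g" for t
    using that
  proof (induction t)
    case Nil
    then show ?case using free_product_lift_BijGroup_Nil[OF nil] by (simp add: \<psi>_def)
  next
    case (Cons x t)
    let ?m = "map (map_sum \<phi> \<chi>)"
    have IH: "\<psi> t [] = ?m t" "reduced_word H K (?m t)"
      using Cons by (auto simp: reduced_word_Cons)
    have r: "reduced_word H K (?m (x # t))"
      using Cons.prems \<phi> \<chi> by (intro reduced_word_map_sum) (auto simp: finite_hom_def)
    have "\<psi> (x # t) [] = case_sum f k x (?m t)"
      using free_product_lift_BijGroup_Cons[OF f k Cons.prems(2) nil] IH by (simp add: \<psi>_def)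
    also have "\<dots> = HK.ball_act n (map_sum \<phi> \<chi> x) (?m t)"
      using IH(2) Cons.prems(1) by (cases x) (auto simp: f_def k_def HK.ball_def)
    also have "\<dots> = ?m (x # t)"
      using HK.reduced_Cons_reduced[of "map_sum \<phi> \<chi> x" "?m t"] r Cons.prems(1)
      by (simp add: HK.ball_act_def)
    finally show ?case using r by simp
  qed
  then have "\<psi> g [] \<noteq> []"
    using g by (simp add: n_def one_G)
  then have "\<psi> g \<noteq> \<one>\<^bsub>BijGroup ?X\<^esub>"
    using BijGroup_one_apply[OF nil] by metis
  moreover obtain J :: "nat monoid" and j where j: "finite_hom (BijGroup ?X) J j" "inj_on j (carrier (BijGroup ?X))"
    using finite_group_nat_copy[of "BijGroup ?X"] hom by (auto simp: finite_hom_def)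
  ultimately have "j (\<psi> g) \<noteq> \<one>\<^bsub>J\<^esub>"
  proof -
    interpret j: group_hom "BijGroup ?X" J j
      using finite_hom_group_hom[OF group_BijGroup j(1)] .
    have "\<psi> g \<in> carrier (BijGroup ?X)" using hom g(1) by (auto simp: finite_hom_def hom_def)
    then show ?thesis
      using j(2) \<open>\<psi> g \<noteq> \<one>\<^bsub>BijGroup ?X\<^esub>\<close> j.hom_one by (metis j.G.one_closed inj_onD)
  qed
  moreover have "finite_hom G J (j \<circ> \<psi>)"
    using hom finite_hom_compose[OF _ j(1)] by (auto simp: finite_hom_def)
  ultimately show "\<exists>(H :: nat monoid) \<phi>. finite_hom G H \<phi> \<and> \<phi> g \<noteq> \<one>\<^bsub>H\<^esub>"
    by (intro exI[of _ J] exI[of _ "j \<circ> \<psi>"]) simp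
qed

end


section \<open>The twisted action\<close>

lemma (in group) commute_nat_pow:
  assumes "x \<in> carrier G" "y \<in> carrier G" "x \<otimes> y = y \<otimes> x"
  shows "x \<otimes> y [^] (n :: nat) = y [^] n \<otimes> x"
proof (induction n)
  case (Suc n)
  have "x \<otimes> y [^] Suc n = y [^] n \<otimes> (x \<otimes> y)"
    using Suc assms(1,2) by (simp flip: m_assoc)
  also have "\<dots> = y [^] Suc n \<otimes> x"
    using assms by (simp add: m_assoc)
  finally show ?case .
qed (use assms in simp)

text \<open>The equation makes \<open>x\<close> a power of \<open>y\<close>, possibly a negative
  one. Used in contrapositive form: an \<open>x\<close> that does not commute with \<open>y\<close>
  carries no power of \<open>y\<close> to a power of \<open>y\<close>, which keeps orbits away from
  marked points.\<close>

lemma (in group) mult_pow_eq_pow_imp_commute: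
  assumes x: "x \<in> carrier G" and y: "y \<in> carrier G" and eq: "x \<otimes> y [^] (k :: nat) = y [^] (l :: nat)"
  shows "x \<otimes> y = y \<otimes> x"
proof -
  have "(x \<otimes> y) \<otimes> y [^] k = (x \<otimes> y [^] k) \<otimes> y"
    using x y commute_nat_pow[OF y y refl, of k] by (simp add: m_assoc)
  also have "\<dots> = y \<otimes> (x \<otimes> y [^] k)"
    using eq y commute_nat_pow[OF y y refl, of l] by simp
  also have "\<dots> = (y \<otimes> x) \<otimes> y [^] k"
    using x y by (simp add: m_assoc)
  finally show ?thesis using x y by (simp add: right_cancel)
qed

text \<open>
  Given a finite quotient \<open>\<phi>\<close>, the group acts on \<open>H \<times> \<int>/L\<close>: the first factor acts through \<open>\<phi>\<close>
  on the left component only, and the action of the second factor is conjugated by two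
  reflections of \<open>\<int>/L\<close>, placed over the points \<open>1\<close> and \<open>c\<close> of \<open>H\<close>. An orbit which visits both
  points once sees the product of the reflections, a rotation of order \<open>L\<close>; an orbit which misses
  one of the points sees only an involution.
\<close>

locale twisted_action = two_groups A B
  for A :: "('a, 'm) monoid_scheme" and B :: "('b, 'n) monoid_scheme" +
  fixes H :: "('c, 'k) monoid_scheme" and \<phi> :: "('a + 'b) list \<Rightarrow> 'c" and c :: 'c and L :: int
  assumes finite_hom: "finite_hom (free_product A B) H \<phi>"
    and c_closed [simp]: "c \<in> carrier H" and c_ne_one: "c \<noteq> \<one>\<^bsub>H\<^esub>" and L_pos: "0 < L"
begin

sublocale \<phi>: group_hom G H \<phi>
  using finite_hom_group_hom[OF G.group_axioms finite_hom] .

lemma finite_H: "finite (carrier H)"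
  using finite_hom by (simp add: finite_hom_def)

lemma phi_closed [simp]: "reduced_word A B w \<Longrightarrow> \<phi> w \<in> carrier H"
  using \<phi>.hom_closed by simp

lemma phi_Nil [simp]: "\<phi> [] = \<one>\<^bsub>H\<^esub>"
  using \<phi>.hom_one by (simp add: one_G)

lemma phi_Cons:
  assumes "reduced_word A B (x # w)"
  shows "\<phi> (x # w) = \<phi> [x] \<otimes>\<^bsub>H\<^esub> \<phi> w"
  using mult_eq_append[of "[x]" w] assms \<phi>.hom_mult[of "[x]" w] by (simp add: reduced_word_Cons)

section \<open>Reflections and the homomorphism into permutations\<close>

definition Z :: "int set" where "Z = {0..<L}"

lemma mod_L_in_Z [simp]: "z mod L \<in> Z" and zero_in_Z [simp]: "0 \<in> Z"
  and mod_L_Z: "z \<in> Z \<Longrightarrow> z mod L = z"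
  using L_pos by (auto simp: Z_def)

text \<open>This map and \<open>refl1\<close> are involutions of \<open>Z\<close>, but
  \<open>refl1\<close> after \<open>refl0\<close> is the shift by 1, of order \<open>L\<close>. The
  twist exploits this contrast.\<close>

definition refl0 :: "int \<Rightarrow> int" where "refl0 z = (- z) mod L"

definition refl1 :: "int \<Rightarrow> int" where "refl1 z = (1 - z) mod L"

definition \<tau> :: "'c \<Rightarrow> int \<Rightarrow> int" where
  "\<tau> q = (if q = \<one>\<^bsub>H\<^esub> then refl0 else if q = c then refl1 else (\<lambda>z. z))"

lemma refl_closed [simp]: "refl0 z \<in> Z" "refl1 z \<in> Z"
  by (simp_all add: refl0_def refl1_def)

lemma refl_refl [simp]:
  assumes "z \<in> Z"
  shows "refl0 (refl0 z) = z" "refl1 (refl1 z) = z"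
  using mod_L_Z[OF assms] by (simp_all add: refl0_def refl1_def mod_minus_eq mod_diff_right_eq)

lemma refl1_refl0: "refl1 (refl0 z) = (z + 1) mod L"
  by (simp add: refl0_def refl1_def mod_diff_right_eq add.commute)

lemma tau_closed [simp]: "z \<in> Z \<Longrightarrow> \<tau> q z \<in> Z"
  by (simp add: \<tau>_def)

lemma tau_tau [simp]: "z \<in> Z \<Longrightarrow> \<tau> q (\<tau> q z) = z"
  by (simp add: \<tau>_def)

abbreviation Y :: "('c \<times> int) set" where "Y \<equiv> carrier H \<times> Z"

fun act_inl :: "'a \<Rightarrow> 'c \<times> int \<Rightarrow> 'c \<times> int" where
  "act_inl a (q, z) = (\<phi> (free_product_inl A a) \<otimes>\<^bsub>H\<^esub> q, z)"

text \<open>With the involution \<open>T (q, z) = (q, \<tau> q z)\<close> of \<open>Y\<close>, this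
  is left translation conjugated by \<open>T\<close>, hence again an action.\<close>

fun act_inr :: "'b \<Rightarrow> 'c \<times> int \<Rightarrow> 'c \<times> int" where
  "act_inr b (q, z) = (\<phi> (free_product_inr B b) \<otimes>\<^bsub>H\<^esub> q, \<tau> (\<phi> (free_product_inr B b) \<otimes>\<^bsub>H\<^esub> q) (\<tau> q z))"

lemma act_inl_hom: "(\<lambda>a. restrict (act_inl a) Y) \<in> hom A (BijGroup Y)"
proof (rule action_hom_BijGroup[OF A.group_axioms])
  fix x assume "x \<in> Y"
  then show "act_inl \<one>\<^bsub>A\<^esub> x = x" by (cases x) (simp add: free_product_inl_def)
next
  fix g h x assume "g \<in> carrier A" "h \<in> carrier A" "x \<in> Y"
  then show "act_inl (g \<otimes>\<^bsub>A\<^esub> h) x = act_inl g (act_inl h x)"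
    using free_product_inl_hom by (cases x) (simp add: hom_mult \<phi>.H.m_assoc)
qed auto

lemma act_inr_hom: "(\<lambda>b. restrict (act_inr b) Y) \<in> hom B (BijGroup Y)"
proof (rule action_hom_BijGroup[OF B.group_axioms])
  fix b x assume "b \<in> carrier B" "x \<in> Y"
  then show "act_inr b x \<in> Y"
    by (cases x) simp
next
  fix x assume "x \<in> Y"
  then show "act_inr \<one>\<^bsub>B\<^esub> x = x"
    by (cases x) (simp add: free_product_inr_def)
next
  fix g h x assume "g \<in> carrier B" "h \<in> carrier B" "x \<in> Y"
  then show "act_inr (g \<otimes>\<^bsub>B\<^esub> h) x = act_inr g (act_inr h x)"
    using free_product_inr_hom
    by (cases x) (simp add: hom_mult \<phi>.H.m_assoc)
qed

definition \<psi> :: "('a + 'b) list \<Rightarrow> 'c \<times> int \<Rightarrow> 'c \<times> int" where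
  "\<psi> = free_product_lift (BijGroup Y) (\<lambda>a. restrict (act_inl a) Y) (\<lambda>b. restrict (act_inr b) Y)"

abbreviation K where "K \<equiv> BijGroup Y"

lemma finite_hom_psi: "finite_hom G K \<psi>"
  using free_product_lift(1)[OF group_BijGroup act_inl_hom act_inr_hom]
  by (simp add: finite_hom_def \<psi>_def group_BijGroup finite_BijGroup finite_H Z_def)

sublocale \<psi>: group_hom G K \<psi>
  using finite_hom_group_hom[OF G.group_axioms finite_hom_psi] .

lemma psi_closed [simp]: "reduced_word A B w \<Longrightarrow> \<psi> w \<in> carrier K"
  using \<psi>.hom_closed by simp

lemma psi_Nil: "p \<in> Y \<Longrightarrow> \<psi> [] p = p"
  unfolding \<psi>_def by (rule free_product_lift_BijGroup_Nil)

text \<open>A word is read from the right, one translation per letter. Only letters of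
  \<open>B\<close> notice marks, at the point left and at the point reached.\<close>

lemma psi_Cons:
  assumes w: "reduced_word A B (x # w)" and q: "q \<in> carrier H" and z: "z \<in> Z"
    and IH: "\<psi> w (q, z) = (\<phi> w \<otimes>\<^bsub>H\<^esub> q, y)"
  shows "\<psi> (x # w) (q, z) = (\<phi> (x # w) \<otimes>\<^bsub>H\<^esub> q,
     if isl x then y else \<tau> (\<phi> (x # w) \<otimes>\<^bsub>H\<^esub> q) (\<tau> (\<phi> w \<otimes>\<^bsub>H\<^esub> q) y))"
proof -
  have r: "reduced_word A B w" "reduced_word A B [x]" using w by (simp_all add: reduced_word_Cons)
  have "\<psi> w (q, z) \<in> Y" using q z by (intro BijGroup_closed[OF psi_closed[OF r(1)]]) simp
  then have Y: "(\<phi> w \<otimes>\<^bsub>H\<^esub> q, y) \<in> Y" unfolding IH .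
  have "\<psi> (x # w) (q, z) = case_sum (\<lambda>a. restrict (act_inl a) Y) (\<lambda>b. restrict (act_inr b) Y) x (\<psi> w (q, z))"
    unfolding \<psi>_def using q z by (intro free_product_lift_BijGroup_Cons[OF act_inl_hom act_inr_hom w]) simp
  also have "\<dots> = (case x of Inl a \<Rightarrow> act_inl a (\<phi> w \<otimes>\<^bsub>H\<^esub> q, y) | Inr b \<Rightarrow> act_inr b (\<phi> w \<otimes>\<^bsub>H\<^esub> q, y))"
    using Y IH by (cases x) simp_all
  also have "\<dots> = (\<phi> (x # w) \<otimes>\<^bsub>H\<^esub> q, if isl x then y else \<tau> (\<phi> (x # w) \<otimes>\<^bsub>H\<^esub> q) (\<tau> (\<phi> w \<otimes>\<^bsub>H\<^esub> q) y))"
  proof (cases x)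
    case (Inl a)
    then have "free_product_inl A a = [x]" using w by (auto simp: free_product_inl_def reduced_word_Cons)
    then show ?thesis using Inl r q phi_Cons[OF w] by (simp add: \<phi>.H.m_assoc)
  next
    case (Inr b)
    then have "free_product_inr B b = [x]" using w by (auto simp: free_product_inr_def reduced_word_Cons)
    then show ?thesis using Inr r q phi_Cons[OF w] by (simp add: \<phi>.H.m_assoc)
  qed
  finally show ?thesis .
qed

text \<open>So \<psi> covers \<phi>, and the order of an image under \<phi> divides the order of its
  image under \<psi>.\<close>

lemma fst_psi:
  assumes "reduced_word A B w" "q \<in> carrier H" "z \<in> Z"
  shows "\<exists>y. \<psi> w (q, z) = (\<phi> w \<otimes>\<^bsub>H\<^esub> q, y)"
  using assms(1)
proof (induction w)
  case Nil
  then show ?case using psi_Nil[of "(q, z)"] assms by simp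
next
  case (Cons x w)
  then show ?case using psi_Cons[OF Cons.prems assms(2,3)] by (auto simp: reduced_word_Cons)
qed

section \<open>Following orbits of the twisted action\<close>

lemma tau_trivial: "q \<notin> {\<one>\<^bsub>H\<^esub>, c} \<Longrightarrow> \<tau> q z = z"
  by (simp add: \<tau>_def)

text \<open>The last letter lies in \<open>B\<close> and acts first, so leaving \<open>q\<close>
  applies \<open>\<tau> q\<close>; every later point is unmarked. The last hypothesis skips the
  empty suffix because \<open>q\<close> may be marked.\<close>

lemma psi_trivial_suffixes:
  assumes "reduced_word A B w" "w \<noteq> []" "\<not> isl (last w)" "q \<in> carrier H" "z \<in> Z"
    and "\<And>i. i < length w \<Longrightarrow> \<phi> (drop i w) \<otimes>\<^bsub>H\<^esub> q \<notin> {\<one>\<^bsub>H\<^esub>, c}"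
  shows "\<psi> w (q, z) = (\<phi> w \<otimes>\<^bsub>H\<^esub> q, \<tau> q z)"
  using assms(1-3,6)
proof (induction w)
  case (Cons x w)
  have x: "\<phi> (x # w) \<otimes>\<^bsub>H\<^esub> q \<notin> {\<one>\<^bsub>H\<^esub>, c}" using Cons.prems(4)[of 0] by simp
  show ?case
  proof (cases "w = []")
    case True
    have "\<psi> w (q, z) = (\<phi> w \<otimes>\<^bsub>H\<^esub> q, z)" using True assms(4,5) psi_Nil[of "(q, z)"] by simp
    then show ?thesis
      using psi_Cons[OF Cons.prems(1) assms(4,5)] True Cons.prems(3) assms(4) tau_trivial[OF x] by simp
  next
    case False
    have d: "\<phi> (drop i w) \<otimes>\<^bsub>H\<^esub> q \<notin> {\<one>\<^bsub>H\<^esub>, c}" if "i < length w" for i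
      using Cons.prems(4)[of "Suc i"] that by simp
    have "\<psi> w (q, z) = (\<phi> w \<otimes>\<^bsub>H\<^esub> q, \<tau> q z)"
      using Cons.prems False d by (intro Cons.IH) (auto simp: reduced_word_Cons)
    then show ?thesis
      using psi_Cons[OF Cons.prems(1) assms(4,5)] tau_trivial[OF x] tau_trivial[OF d[of 0]] False by simp
  qed
qed simp

text \<open>The first letter lies in \<open>A\<close>, so reaching the end point applies no
  reflection and that point may be marked too. When \<open>w\<close> is repeated, the mark of a
  start point thus acts exactly once, on leaving it.\<close>

lemma psi_alternating:
  assumes w: "alternating w" and q: "q \<in> carrier H" "z \<in> Z"
    and d: "\<And>i. 0 < i \<Longrightarrow> i < length w \<Longrightarrow> \<phi> (drop i w) \<otimes>\<^bsub>H\<^esub> q \<notin> {\<one>\<^bsub>H\<^esub>, c}"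
  shows "\<psi> w (q, z) = (\<phi> w \<otimes>\<^bsub>H\<^esub> q, \<tau> q z)"
proof -
  obtain x t where wt: "w = x # t" using w by (cases w) (auto simp: alternating_def)
  have "t \<noteq> []" using w wt by (auto simp: alternating_def)
  have "\<psi> t (q, z) = (\<phi> t \<otimes>\<^bsub>H\<^esub> q, \<tau> q z)"
  proof (rule psi_trivial_suffixes)
    show "\<phi> (drop i t) \<otimes>\<^bsub>H\<^esub> q \<notin> {\<one>\<^bsub>H\<^esub>, c}" if "i < length t" for i
      using d[of "Suc i"] that wt by simp
  qed (use w wt q \<open>t \<noteq> []\<close> in \<open>auto simp: alternating_def reduced_word_Cons\<close>)
  then show ?thesis
    using psi_Cons[of x t q z] w q wt by (simp add: alternating_def)
qed

text \<open>The cycle of the identity under \<open>\<phi> w\<close> runs through the powers of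
  \<open>\<phi> w\<close>. By \<open>suffix\<close> the points in between are no such powers, so
  marks are met only at the identity and at \<open>c\<close>, once each. One round therefore shifts
  the fibre over the identity by 1, and returning to the start takes a multiple of \<open>L\<close>
  rounds.\<close>

lemma L_dvd_ord:
  assumes w: "alternating w"
    and suffix: "\<And>i. 0 < i \<Longrightarrow> i < length w \<Longrightarrow> \<phi> (drop i w) \<otimes>\<^bsub>H\<^esub> \<phi> w \<noteq> \<phi> w \<otimes>\<^bsub>H\<^esub> \<phi> (drop i w)"
    and c: "c = \<phi> w [^]\<^bsub>H\<^esub> (m :: nat)"
  shows "L dvd int (group.ord K (\<psi> w))"
proof -
  let ?W = "\<phi> w"
  have rw: "reduced_word A B w" using w by (simp add: alternating_def)
  then have W: "?W \<in> carrier H" by simp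
  define M where "M = \<phi>.H.ord ?W"
  have M: "0 < M" using \<phi>.H.ord_ge_1[OF finite_H W] by (simp add: M_def)
  \<comment> \<open>The position of \<open>c\<close> on the cycle of length \<open>M\<close>; it is
    positive because \<open>c\<close> is not the identity.\<close>
  define k where "k = m mod M"
  have k: "k < M" "c = ?W [^]\<^bsub>H\<^esub> k"
  proof -
    show "k < M" using M by (simp add: k_def)
    have "?W [^]\<^bsub>H\<^esub> m = ?W [^]\<^bsub>H\<^esub> (M * (m div M) + k)" by (simp add: k_def)
    also have "\<dots> = ?W [^]\<^bsub>H\<^esub> k"
      using W by (simp add: M_def flip: \<phi>.H.nat_pow_mult \<phi>.H.nat_pow_pow)
    finally show "c = ?W [^]\<^bsub>H\<^esub> k" using c by simp
  qed
  have "0 < k" using k c_ne_one by (cases "k = 0") auto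
  have inj: "?W [^]\<^bsub>H\<^esub> i = ?W [^]\<^bsub>H\<^esub> j \<longleftrightarrow> i = j" if "i < M" "j < M" for i j :: nat
    using \<phi>.H.ord_inj[OF W] that by (fastforce simp: M_def inj_on_def)
  have tau_pow: "\<tau> (?W [^]\<^bsub>H\<^esub> n) = (if n = 0 then refl0 else if n = k then refl1 else (\<lambda>z. z))" if "n < M" for n
    using inj[of n 0] inj[of n k] that k(1) M unfolding k(2)[symmetric] \<tau>_def by simp
  have step: "\<psi> w (?W [^]\<^bsub>H\<^esub> n, z) = (?W [^]\<^bsub>H\<^esub> Suc n, \<tau> (?W [^]\<^bsub>H\<^esub> n) z)" if z: "z \<in> Z" for n :: nat and z
  proof -
    have "\<phi> (drop i w) \<otimes>\<^bsub>H\<^esub> ?W [^]\<^bsub>H\<^esub> n \<notin> {\<one>\<^bsub>H\<^esub>, c}" if i: "0 < i" "i < length w" for i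
    proof -
      have "reduced_word A B (drop i w)"
        using rw reduced_word_append[of "take i w" "drop i w"] by simp
      then have "\<phi> (drop i w) \<in> carrier H" by simp
      then have "\<phi> (drop i w) \<otimes>\<^bsub>H\<^esub> ?W [^]\<^bsub>H\<^esub> n \<noteq> ?W [^]\<^bsub>H\<^esub> l" for l :: nat
        using \<phi>.H.mult_pow_eq_pow_imp_commute W suffix[OF i] by blast
      from this[of 0] this[of k] show ?thesis using k(2) by simp
    qed
    then show ?thesis
      using psi_alternating[OF w _ z, of "?W [^]\<^bsub>H\<^esub> n"] W by (simp add: \<phi>.H.commute_nat_pow)
  qed
  \<comment> \<open>\<open>refl0\<close> is applied on leaving exponent 0 and \<open>refl1\<close>
    on leaving exponent \<open>k\<close>, so the latter first shows at
    \<open>n = k + 1\<close>.\<close>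
  have powers: "(\<psi> w [^]\<^bsub>K\<^esub> n) (\<one>\<^bsub>H\<^esub>, z) =
      (?W [^]\<^bsub>H\<^esub> n, if n = 0 then z else if n \<le> k then refl0 z else refl1 (refl0 z))"
    if "n \<le> M" and z: "z \<in> Z" for n z
    using that(1)
  proof (induction n)
    case 0
    then show ?case using z by (simp add: BijGroup_one_apply)
  next
    case (Suc n)
    have "(\<psi> w [^]\<^bsub>K\<^esub> Suc n) (\<one>\<^bsub>H\<^esub>, z) = \<psi> w ((\<psi> w [^]\<^bsub>K\<^esub> n) (\<one>\<^bsub>H\<^esub>, z))"
      using z rw by (intro BijGroup_pow_Suc_apply) auto
    also have "\<dots> = \<psi> w (?W [^]\<^bsub>H\<^esub> n, if n = 0 then z else if n \<le> k then refl0 z else refl1 (refl0 z))"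
      using Suc by simp
    also have "\<dots> = (?W [^]\<^bsub>H\<^esub> Suc n, \<tau> (?W [^]\<^bsub>H\<^esub> n) (if n = 0 then z else if n \<le> k then refl0 z else refl1 (refl0 z)))"
      using z refl_closed by (intro step) simp
    also have "\<tau> (?W [^]\<^bsub>H\<^esub> n) (if n = 0 then z else if n \<le> k then refl0 z else refl1 (refl0 z)) =
        (if Suc n = 0 then z else if Suc n \<le> k then refl0 z else refl1 (refl0 z))"
      using tau_pow[of n] Suc.prems \<open>0 < k\<close> by auto
    finally show ?case .
  qed
  have cycle: "(\<psi> w [^]\<^bsub>K\<^esub> M) (\<one>\<^bsub>H\<^esub>, z) = (\<one>\<^bsub>H\<^esub>, (z + 1) mod L)" if "z \<in> Z" for z
    using powers[OF le_refl that] k(1) M W by (simp add: refl1_refl0 M_def)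
  have pw: "\<psi> w [^]\<^bsub>K\<^esub> M \<in> carrier K" using rw by simp
  have cycles: "((\<psi> w [^]\<^bsub>K\<^esub> M) [^]\<^bsub>K\<^esub> n) (\<one>\<^bsub>H\<^esub>, 0) = (\<one>\<^bsub>H\<^esub>, int n mod L)" for n
  proof (induction n)
    case 0
    then show ?case by (simp add: BijGroup_one_apply)
  next
    case (Suc n)
    have "((\<psi> w [^]\<^bsub>K\<^esub> M) [^]\<^bsub>K\<^esub> Suc n) (\<one>\<^bsub>H\<^esub>, 0) = (\<psi> w [^]\<^bsub>K\<^esub> M) (((\<psi> w [^]\<^bsub>K\<^esub> M) [^]\<^bsub>K\<^esub> n) (\<one>\<^bsub>H\<^esub>, 0))"
      using pw by (intro BijGroup_pow_Suc_apply) auto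
    then show ?case
      using Suc cycle[of "int n mod L"] by (simp add: mod_simps add.commute)
  qed
  define N where "N = \<psi>.H.ord (\<psi> w)"
  have N: "\<psi> w [^]\<^bsub>K\<^esub> N = \<one>\<^bsub>K\<^esub>" using rw by (simp add: N_def)
  \<comment> \<open>Since \<psi> covers \<phi>, the order of \<open>\<psi> w\<close> amounts to a
    whole number of rounds.\<close>
  have "\<psi> (w [^]\<^bsub>G\<^esub> N) = \<one>\<^bsub>K\<^esub>" using N rw \<psi>.hom_nat_pow[of w N] by simp
  then have "\<phi> (w [^]\<^bsub>G\<^esub> N) = \<one>\<^bsub>H\<^esub>"
    using fst_psi[of "w [^]\<^bsub>G\<^esub> N" "\<one>\<^bsub>H\<^esub>" 0] rw BijGroup_one_apply[of "(\<one>\<^bsub>H\<^esub>, 0)" Y] G.nat_pow_closed[of w N]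
    by simp
  then have "M dvd N" using rw \<phi>.hom_nat_pow[of w N] \<phi>.H.pow_eq_id[OF W] by (simp add: M_def)
  then obtain n where n: "N = M * n" by blast
  have "(\<one>\<^bsub>H\<^esub>, int n mod L) = (\<one>\<^bsub>H\<^esub>, 0)"
    using cycles[of n] N n rw \<psi>.H.nat_pow_pow[of "\<psi> w" M n] by (simp add: BijGroup_one_apply)
  then have "L dvd int n" by auto
  then show ?thesis using n by (simp add: N_def)
qed

text \<open>All marks met carry the same involution \<sigma>, and any composite of copies of it is
  the identity or \<sigma>.\<close>

lemma psi_one_reflection:
  assumes w: "reduced_word A B w" and q: "q \<in> carrier H" and \<sigma>: "\<sigma> \<in> {refl0, refl1}"
    and d: "\<And>i. \<tau> (\<phi> (drop i w) \<otimes>\<^bsub>H\<^esub> q) \<in> {\<lambda>z. z, \<sigma>}"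
  shows "\<exists>\<rho>\<in>{\<lambda>z. z, \<sigma>}. \<forall>z\<in>Z. \<psi> w (q, z) = (\<phi> w \<otimes>\<^bsub>H\<^esub> q, \<rho> z)"
  using w d
proof (induction w)
  case Nil
  then show ?case using q psi_Nil by (intro bexI[of _ "\<lambda>z. z"]) auto
next
  case (Cons x w)
  have d: "\<tau> (\<phi> (drop i w) \<otimes>\<^bsub>H\<^esub> q) \<in> {\<lambda>z. z, \<sigma>}" for i
    using Cons.prems(2)[of "Suc i"] unfolding drop_Suc_Cons .
  obtain \<rho> where \<rho>: "\<rho> \<in> {\<lambda>z. z, \<sigma>}" "\<And>z. z \<in> Z \<Longrightarrow> \<psi> w (q, z) = (\<phi> w \<otimes>\<^bsub>H\<^esub> q, \<rho> z)"
    using Cons.IH[OF _ d] Cons.prems(1) unfolding reduced_word_Cons by blast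
  let ?t = "\<tau> (\<phi> (x # w) \<otimes>\<^bsub>H\<^esub> q)" and ?s = "\<tau> (\<phi> w \<otimes>\<^bsub>H\<^esub> q)"
  have psi: "\<psi> (x # w) (q, z) = (\<phi> (x # w) \<otimes>\<^bsub>H\<^esub> q, if isl x then \<rho> z else ?t (?s (\<rho> z)))" if "z \<in> Z" for z
    using psi_Cons[OF Cons.prems(1) q that \<rho>(2)[OF that]] .
  have ts: "?t \<in> {\<lambda>z. z, \<sigma>}" "?s \<in> {\<lambda>z. z, \<sigma>}" using Cons.prems(2)[of 0] d[of 0] unfolding drop_0 .
  have \<sigma>\<sigma>: "\<sigma> (\<sigma> z) = z" if "z \<in> Z" for z
    using \<sigma> that by auto
  have "\<exists>\<rho>'\<in>{\<lambda>z. z, \<sigma>}. \<forall>z\<in>Z. ?t (?s (\<rho> z)) = \<rho>' z"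
    using ts \<rho>(1) \<sigma>\<sigma> by auto
  then show ?case
    using psi \<rho>(1) by (cases "isl x") auto
qed

text \<open>By \<open>miss\<close>, no orbit of \<open>\<phi> v\<close>, together with the points
  passed on the way, meets both marks. So \<open>ord (\<phi> v)\<close> steps change a fibre by at
  most one involution, and twice as many restore it.\<close>

lemma psi_pow_eq_one:
  assumes v: "reduced_word A B v"
    and miss: "\<And>i j. inv\<^bsub>H\<^esub> \<phi> (drop j v) \<otimes>\<^bsub>H\<^esub> c \<otimes>\<^bsub>H\<^esub> \<phi> (drop i v) \<otimes>\<^bsub>H\<^esub> \<phi> v \<noteq>
       \<phi> v \<otimes>\<^bsub>H\<^esub> (inv\<^bsub>H\<^esub> \<phi> (drop j v) \<otimes>\<^bsub>H\<^esub> c \<otimes>\<^bsub>H\<^esub> \<phi> (drop i v))"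
  shows "\<psi> v [^]\<^bsub>K\<^esub> (\<phi>.H.ord (\<phi> v) * 2) = \<one>\<^bsub>K\<^esub>"
proof (rule BijGroup_eq_oneI)
  have V: "\<phi> v \<in> carrier H" using v by simp
  have dc: "\<phi> (drop i v) \<in> carrier H" for i
    using v reduced_word_append[of "take i v" "drop i v"] by simp
  show "\<psi> v [^]\<^bsub>K\<^esub> (\<phi>.H.ord (\<phi> v) * 2) \<in> carrier K" using v by simp
  fix p assume "p \<in> Y"
  then obtain q z0 where p: "p = (q, z0)" "q \<in> carrier H" "z0 \<in> Z" by auto
  let ?x = "\<lambda>i (k :: nat). \<phi> (drop i v) \<otimes>\<^bsub>H\<^esub> (\<phi> v [^]\<^bsub>H\<^esub> k \<otimes>\<^bsub>H\<^esub> q)"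
  \<comment> \<open>Eliminating \<open>q\<close> from the two equations shows that \<open>?g\<close>
    carries one power of \<open>\<phi> v\<close> to another, so \<open>?g\<close> would commute with
    \<open>\<phi> v\<close>.\<close>
  have not_both: False if "?x i k = \<one>\<^bsub>H\<^esub>" "?x j l = c" for i j k l
  proof -
    let ?g = "inv\<^bsub>H\<^esub> \<phi> (drop j v) \<otimes>\<^bsub>H\<^esub> c \<otimes>\<^bsub>H\<^esub> \<phi> (drop i v)"
    have g: "?g \<in> carrier H" using dc by simp
    have "q \<otimes>\<^bsub>H\<^esub> (\<phi> (drop i v) \<otimes>\<^bsub>H\<^esub> \<phi> v [^]\<^bsub>H\<^esub> k) = \<one>\<^bsub>H\<^esub>"
      using that(1) dc V p(2) by (metis \<phi>.H.inv_comm \<phi>.H.m_assoc \<phi>.H.m_closed \<phi>.H.nat_pow_closed)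
    moreover have "inv\<^bsub>H\<^esub> \<phi> (drop j v) \<otimes>\<^bsub>H\<^esub> c = \<phi> v [^]\<^bsub>H\<^esub> l \<otimes>\<^bsub>H\<^esub> q"
      using that(2) dc[of j] V p(2) by (simp add: \<phi>.H.inv_mult_cancel flip: that(2))
    ultimately have "?g \<otimes>\<^bsub>H\<^esub> \<phi> v [^]\<^bsub>H\<^esub> k = \<phi> v [^]\<^bsub>H\<^esub> l"
      using dc[of i] V p(2) by (simp add: \<phi>.H.m_assoc)
    then show False
      using \<phi>.H.mult_pow_eq_pow_imp_commute[OF g V] miss by blast
  qed
  \<comment> \<open>If the orbit meets the identity, it misses \<open>c\<close> and only
    \<open>refl0\<close> can occur; otherwise only \<open>refl1\<close> can.\<close>
  obtain \<sigma> where \<sigma>: "\<sigma> \<in> {refl0, refl1}" "\<And>i k. \<tau> (?x i k) \<in> {\<lambda>z. z, \<sigma>}"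
  proof (cases "\<exists>i k. ?x i k = \<one>\<^bsub>H\<^esub>")
    case True
    then have "?x i k \<noteq> c" for i k using not_both by blast
    then show ?thesis using that[of refl0] by (auto simp: \<tau>_def)
  next
    case False
    then show ?thesis using that[of refl1] by (auto simp: \<tau>_def)
  qed
  have \<sigma>\<sigma>: "\<sigma> (\<sigma> z) = z" "\<sigma> z \<in> Z" if "z \<in> Z" for z
    using \<sigma>(1) that by auto
  have "\<exists>\<rho>\<in>{\<lambda>z. z, \<sigma>}. \<forall>z\<in>Z. (\<psi> v [^]\<^bsub>K\<^esub> n) (q, z) = (\<phi> v [^]\<^bsub>H\<^esub> n \<otimes>\<^bsub>H\<^esub> q, \<rho> z)" for n :: nat
  proof (induction n)
    case 0
    then show ?case using p(2) by (intro bexI[of _ "\<lambda>z. z"]) (auto simp: BijGroup_one_apply)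
  next
    case (Suc n)
    then obtain \<rho> where \<rho>: "\<rho> \<in> {\<lambda>z. z, \<sigma>}"
      "\<And>z. z \<in> Z \<Longrightarrow> (\<psi> v [^]\<^bsub>K\<^esub> n) (q, z) = (\<phi> v [^]\<^bsub>H\<^esub> n \<otimes>\<^bsub>H\<^esub> q, \<rho> z)" by blast
    obtain \<rho>' where \<rho>': "\<rho>' \<in> {\<lambda>z. z, \<sigma>}"
      "\<And>z. z \<in> Z \<Longrightarrow> \<psi> v (\<phi> v [^]\<^bsub>H\<^esub> n \<otimes>\<^bsub>H\<^esub> q, z) = (\<phi> v \<otimes>\<^bsub>H\<^esub> (\<phi> v [^]\<^bsub>H\<^esub> n \<otimes>\<^bsub>H\<^esub> q), \<rho>' z)"
      using psi_one_reflection[OF v _ \<sigma>(1), of "\<phi> v [^]\<^bsub>H\<^esub> n \<otimes>\<^bsub>H\<^esub> q"] \<sigma>(2) V p(2) by blast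
    have "(\<psi> v [^]\<^bsub>K\<^esub> Suc n) (q, z) = (\<phi> v [^]\<^bsub>H\<^esub> Suc n \<otimes>\<^bsub>H\<^esub> q, \<rho>' (\<rho> z))" if z: "z \<in> Z" for z
    proof -
      have "\<rho> z \<in> Z" using \<rho>(1) z \<sigma>\<sigma> by auto
      moreover have "(\<psi> v [^]\<^bsub>K\<^esub> Suc n) (q, z) = \<psi> v ((\<psi> v [^]\<^bsub>K\<^esub> n) (q, z))"
        using z v p(2) by (intro BijGroup_pow_Suc_apply) auto
      moreover have "\<phi> v \<otimes>\<^bsub>H\<^esub> (\<phi> v [^]\<^bsub>H\<^esub> n \<otimes>\<^bsub>H\<^esub> q) = \<phi> v [^]\<^bsub>H\<^esub> Suc n \<otimes>\<^bsub>H\<^esub> q"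
        using V p(2) \<phi>.H.nat_pow_Suc2[OF V] by (simp add: \<phi>.H.m_assoc del: \<phi>.H.nat_pow_Suc)
      ultimately show ?thesis using \<rho>(2)[OF z] \<rho>'(2) by simp
    qed
    moreover have "\<exists>\<rho>''\<in>{\<lambda>z. z, \<sigma>}. \<forall>z\<in>Z. \<rho>' (\<rho> z) = \<rho>'' z"
      using \<rho>(1) \<rho>'(1) \<sigma>\<sigma>(1) by auto
    ultimately show ?case by auto
  qed
  from this[of "\<phi>.H.ord (\<phi> v)"] have "\<exists>\<rho>\<in>{\<lambda>z. z, \<sigma>}. \<forall>z\<in>Z.
     (\<psi> v [^]\<^bsub>K\<^esub> \<phi>.H.ord (\<phi> v)) (q, z) = (q, \<rho> z)"
    using V p(2) by simp
  then obtain \<rho> where \<rho>: "\<rho> \<in> {\<lambda>z. z, \<sigma>}"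
     "\<And>z. z \<in> Z \<Longrightarrow> (\<psi> v [^]\<^bsub>K\<^esub> \<phi>.H.ord (\<phi> v)) (q, z) = (q, \<rho> z)"
    by blast
  let ?f = "\<psi> v [^]\<^bsub>K\<^esub> \<phi>.H.ord (\<phi> v)"
  have f: "?f \<in> carrier K" using v by simp
  have "\<rho> z0 \<in> Z" "\<rho> (\<rho> z0) = z0" using \<rho>(1) \<sigma>\<sigma> p(3) by auto
  then have "?f (?f p) = p" using \<rho>(2) p by simp
  moreover have "\<psi> v [^]\<^bsub>K\<^esub> (\<phi>.H.ord (\<phi> v) * 2) = ?f \<otimes>\<^bsub>K\<^esub> ?f"
    using v by (simp add: mult_2_right flip: \<psi>.H.nat_pow_mult)
  ultimately show "(\<psi> v [^]\<^bsub>K\<^esub> (\<phi>.H.ord (\<phi> v) * 2)) p = p"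
    using BijGroup_mult_apply[OF f f \<open>p \<in> Y\<close>] by simp
qed

end


section \<open>Separating orders\<close>

lemma (in group) commutator_eq_one_iff:
  assumes "x \<in> carrier G" "y \<in> carrier G"
  shows "x \<otimes> y \<otimes> inv (y \<otimes> x) = \<one> \<longleftrightarrow> x \<otimes> y = y \<otimes> x"
  using assms by (metis inv_closed inv_inv inv_unique' m_closed r_inv inv_equality)

text \<open>Images fail to commute exactly if the commutator survives, so finitely many such demands
  reduce to residual finiteness. The extra element \<open>g\<close> serves to make the marked point
  \<open>c\<close> nontrivial.\<close>

lemma residually_finite_not_commute:
  assumes G: "group G" "residually_finite G" and S: "finite S" "S \<subseteq> carrier G \<times> carrier G"
    and nc: "\<And>x y. (x, y) \<in> S \<Longrightarrow> x \<otimes>\<^bsub>G\<^esub> y \<noteq> y \<otimes>\<^bsub>G\<^esub> x"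
    and g: "g \<in> carrier G" "g \<noteq> \<one>\<^bsub>G\<^esub>"
  obtains H :: "nat monoid" and \<phi> where "finite_hom G H \<phi>" "\<phi> g \<noteq> \<one>\<^bsub>H\<^esub>"
    "\<And>x y. (x, y) \<in> S \<Longrightarrow> \<phi> x \<otimes>\<^bsub>H\<^esub> \<phi> y \<noteq> \<phi> y \<otimes>\<^bsub>H\<^esub> \<phi> x"
proof -
  interpret group G by fact
  let ?c = "\<lambda>(x, y). x \<otimes>\<^bsub>G\<^esub> y \<otimes>\<^bsub>G\<^esub> inv\<^bsub>G\<^esub> (y \<otimes>\<^bsub>G\<^esub> x)"
  have "finite (insert g (?c ` S))" "insert g (?c ` S) \<subseteq> carrier G"
    using S g by auto
  moreover have "\<one>\<^bsub>G\<^esub> \<notin> insert g (?c ` S)"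
  proof
    assume "\<one>\<^bsub>G\<^esub> \<in> insert g (?c ` S)"
    then obtain x y where xy: "(x, y) \<in> S" "x \<otimes>\<^bsub>G\<^esub> y \<otimes>\<^bsub>G\<^esub> inv\<^bsub>G\<^esub> (y \<otimes>\<^bsub>G\<^esub> x) = \<one>\<^bsub>G\<^esub>"
      using g by fastforce
    then show False using S(2) nc[OF xy(1)] commutator_eq_one_iff[of x y] by auto
  qed
  ultimately obtain H :: "nat monoid" and \<phi> where \<phi>: "finite_hom G H \<phi>"
    "\<forall>x\<in>insert g (?c ` S). \<phi> x \<noteq> \<one>\<^bsub>H\<^esub>"
    using residually_finite_finite_set[OF G] by meson
  interpret \<phi>: group_hom G H \<phi> using finite_hom_group_hom[OF G(1) \<phi>(1)] .
  have "\<phi> x \<otimes>\<^bsub>H\<^esub> \<phi> y \<noteq> \<phi> y \<otimes>\<^bsub>H\<^esub> \<phi> x" if xy: "(x, y) \<in> S" for x y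
  proof -
    have c: "x \<in> carrier G" "y \<in> carrier G" using S(2) xy by auto
    have "\<phi> (?c (x, y)) \<noteq> \<one>\<^bsub>H\<^esub>" using \<phi>(2) xy by blast
    then have "\<phi> x \<otimes>\<^bsub>H\<^esub> \<phi> y \<otimes>\<^bsub>H\<^esub> inv\<^bsub>H\<^esub> (\<phi> y \<otimes>\<^bsub>H\<^esub> \<phi> x) \<noteq> \<one>\<^bsub>H\<^esub>" using c by simp
    then show ?thesis using \<phi>.H.commutator_eq_one_iff[of "\<phi> x" "\<phi> y"] c by simp
  qed
  then show ?thesis using that[OF \<phi>(1)] \<phi>(2) by blast
qed

text \<open>For positive \<open>i\<close> both \<open>r\<close> and \<open>i\<close> divide the
  order, and the two quotients differ. For \<open>i = 0\<close> the factor 2 matters: the first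
  order is even, the second is 1.\<close>

lemma (in group) ord_pow_neq:
  assumes x: "x \<in> carrier G" "0 < ord x" and dvd: "2 * r * max i 1 dvd ord x" and "0 < r" "i \<noteq> r"
  shows "ord (x [^] r) \<noteq> ord (x [^] (i :: nat))"
proof -
  obtain t where t: "ord x = 2 * r * max i 1 * t" using dvd by blast
  then have t0: "0 < t" using x(2) by (cases t) auto
  have r: "ord (x [^] r) = ord x div r" using x t assms(4) by (intro ord_pow) auto
  show ?thesis
  proof (cases "i = 0")
    case True
    then show ?thesis using r t t0 assms(4) by simp
  next
    case False
    then have t': "ord x = 2 * r * i * t" using t by (simp add: max_absorb1)
    then have "ord (x [^] i) = ord x div i" using x False by (intro ord_pow) auto
    moreover have "ord x div i = 2 * r * t" "ord x div r = 2 * i * t"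
      using t' False assms(4) by simp_all
    ultimately show ?thesis using r t0 assms(5) by simp
  qed
qed

context two_groups
begin

lemma reduced_word_drop [simp]: "reduced_word A B w \<Longrightarrow> reduced_word A B (drop i w)"
  using reduced_word_append[of "take i w" "drop i w"] by simp

lemma reduced_word_mult [simp]: "reduced_word A B u \<Longrightarrow> reduced_word A B v \<Longrightarrow> reduced_word A B (u \<otimes>\<^bsub>G\<^esub> v)"
  and reduced_word_inv [simp]: "reduced_word A B u \<Longrightarrow> reduced_word A B (inv\<^bsub>G\<^esub> u)"
  and reduced_word_nat_pow [simp]: "reduced_word A B u \<Longrightarrow> reduced_word A B (u [^]\<^bsub>G\<^esub> (n :: nat))"
  using G.m_closed[of u v] G.inv_closed[of u] G.nat_pow_closed[of u n] by simp_all

lemma drop_not_commute: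
  assumes "alternating w" "primitive_list w" "0 < i" "i < length w"
  shows "drop i w \<otimes>\<^bsub>G\<^esub> w \<noteq> w \<otimes>\<^bsub>G\<^esub> drop i w"
  using suffix_not_commute[OF assms(1,2), of "take i w" "drop i w"] assms(3,4) by fastforce

text \<open>Orders are unchanged by conjugation and inversion, so \<open>v\<close> can be traded for
  the power of \<open>w\<close> with exponent \<open>i\<close>. It then suffices to give
  \<open>w\<close> an order divisible by the number demanded in \<open>ord_pow_neq\<close>.\<close>

lemma orders_differ_commensurable:
  assumes "residually_finite G" and w: "alternating w" "primitive_list w"
    and r: "0 < r" "i \<noteq> r" and v: "v \<in> carrier G" "conjugate_in G v v'"
    and v': "v' = w [^]\<^bsub>G\<^esub> i \<or> inv\<^bsub>G\<^esub> v' = w [^]\<^bsub>G\<^esub> (i :: nat)"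
  shows "orders_differ G (w [^]\<^bsub>G\<^esub> r) v"
proof -
  have wc: "w \<in> carrier G" "w \<noteq> \<one>\<^bsub>G\<^esub>" using w by (auto simp: alternating_def one_G)
  let ?S = "(\<lambda>i. (drop i w, w)) ` {0<..<length w}"
  have S: "finite ?S" "?S \<subseteq> carrier G \<times> carrier G"
    using wc by auto
  have nc: "x \<otimes>\<^bsub>G\<^esub> y \<noteq> y \<otimes>\<^bsub>G\<^esub> x" if "(x, y) \<in> ?S" for x y
    using that drop_not_commute[OF w] by auto
  obtain H :: "nat monoid" and \<phi> where \<phi>: "finite_hom G H \<phi>" "\<phi> w \<noteq> \<one>\<^bsub>H\<^esub>"
    "\<And>x y. (x, y) \<in> ?S \<Longrightarrow> \<phi> x \<otimes>\<^bsub>H\<^esub> \<phi> y \<noteq> \<phi> y \<otimes>\<^bsub>H\<^esub> \<phi> x"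
    using residually_finite_not_commute[OF G.group_axioms assms(1) S nc wc] by blast
  interpret \<phi>: group_hom G H \<phi> using finite_hom_group_hom[OF G.group_axioms \<phi>(1)] .
  define L c where "L = 2 * r * max i 1" and "c = \<phi> w"
  interpret T: twisted_action A B H \<phi> c "int L"
    using \<phi> wc r by unfold_locales (auto simp: L_def c_def simp del: carrier_G)
  have "int L dvd int (T.\<psi>.H.ord (T.\<psi> w))"
    using \<phi>.hom_closed[OF wc(1)] \<phi>(3) by (intro T.L_dvd_ord[OF w(1), of 1]) (auto simp: c_def)
  then have dvd: "2 * r * max i 1 dvd T.\<psi>.H.ord (T.\<psi> w)" by (simp only: int_dvd_int_iff L_def)
  have pw: "T.\<psi> w \<in> carrier T.K" using wc by simp
  have pos: "0 < T.\<psi>.H.ord (T.\<psi> w)"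
    using T.\<psi>.H.ord_ge_1[OF _ pw] T.finite_hom_psi by (simp add: finite_hom_def)
  have v'c: "v' \<in> carrier G" using conjugate_in_closed[OF G.group_axioms v] .
  have "T.\<psi>.H.ord (T.\<psi> v') = T.\<psi>.H.ord (T.\<psi> w [^]\<^bsub>T.K\<^esub> i)"
    using v'
  proof
    assume "v' = w [^]\<^bsub>G\<^esub> i"
    then show ?thesis using wc T.\<psi>.hom_nat_pow by simp
  next
    assume "inv\<^bsub>G\<^esub> v' = w [^]\<^bsub>G\<^esub> i"
    then have "inv\<^bsub>T.K\<^esub> (T.\<psi> v') = T.\<psi> w [^]\<^bsub>T.K\<^esub> i"
      using wc v'c T.\<psi>.hom_nat_pow[of w i] T.\<psi>.hom_inv[of v'] by simp
    then show ?thesis using T.\<psi>.H.ord_inv[of "T.\<psi> v'"] v'c by simp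
  qed
  also have "T.\<psi>.H.ord (T.\<psi> v') = T.\<psi>.H.ord (T.\<psi> v)"
    using ord_hom_conjugate_in[OF T.\<psi>.group_hom_axioms v] .
  finally have "T.\<psi>.H.ord (T.\<psi> (w [^]\<^bsub>G\<^esub> r)) \<noteq> T.\<psi>.H.ord (T.\<psi> v)"
    using T.\<psi>.H.ord_pow_neq[OF pw pos dvd r] wc T.\<psi>.hom_nat_pow[of w r] by simp
  then show ?thesis
    using orders_differI[OF G.group_axioms T.finite_hom_psi _ v(1)] wc G.nat_pow_closed by blast
qed

text \<open>For fixed \<open>s\<close> and \<open>t\<close> at most one exponent is bad: two bad
  ones \<open>m < n\<close> would make a conjugate of \<open>w ^ (n - m)\<close> commute with
  \<open>v\<close>, against \<open>nc\<close>. Finitely many pairs thus exclude finitely many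
  \<open>m\<close>.\<close>

lemma exists_not_commute:
  assumes w: "w \<in> carrier G" and v: "v \<in> carrier G"
    and nc: "\<And>k g. 0 < k \<Longrightarrow> g \<in> carrier G \<Longrightarrow>
      (g \<otimes>\<^bsub>G\<^esub> v \<otimes>\<^bsub>G\<^esub> inv\<^bsub>G\<^esub> g) \<otimes>\<^bsub>G\<^esub> w [^]\<^bsub>G\<^esub> (k :: nat) \<noteq> w [^]\<^bsub>G\<^esub> k \<otimes>\<^bsub>G\<^esub> (g \<otimes>\<^bsub>G\<^esub> v \<otimes>\<^bsub>G\<^esub> inv\<^bsub>G\<^esub> g)"
    and T: "finite T" "T \<subseteq> carrier G"
  shows "\<exists>m::nat. \<forall>s\<in>T. \<forall>t\<in>T.
    inv\<^bsub>G\<^esub> t \<otimes>\<^bsub>G\<^esub> w [^]\<^bsub>G\<^esub> m \<otimes>\<^bsub>G\<^esub> s \<otimes>\<^bsub>G\<^esub> v \<noteq> v \<otimes>\<^bsub>G\<^esub> (inv\<^bsub>G\<^esub> t \<otimes>\<^bsub>G\<^esub> w [^]\<^bsub>G\<^esub> m \<otimes>\<^bsub>G\<^esub> s)"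
proof -
  let ?c = "\<lambda>(s, t) m. inv\<^bsub>G\<^esub> t \<otimes>\<^bsub>G\<^esub> w [^]\<^bsub>G\<^esub> (m :: nat) \<otimes>\<^bsub>G\<^esub> s"
  define bad where "bad p = {m. ?c p m \<otimes>\<^bsub>G\<^esub> v = v \<otimes>\<^bsub>G\<^esub> ?c p m}" for p
  have uniq: "\<not> m < n" if p: "p \<in> T \<times> T" and m: "m \<in> bad p" and n: "n \<in> bad p" for p m n
  proof
    assume "m < n"
    obtain s t where p': "p = (s, t)" and s: "s \<in> carrier G" and t: "t \<in> carrier G"
      using p T(2) by blast
    \<comment> \<open>\<open>d\<close> is the quotient of the elements for \<open>n\<close> and
      \<open>m\<close>. Both commute with \<open>v\<close>, hence so does \<open>d\<close>.\<close>
    define k d where "k = w [^]\<^bsub>G\<^esub> (n - m)" and "d = inv\<^bsub>G\<^esub> t \<otimes>\<^bsub>G\<^esub> k \<otimes>\<^bsub>G\<^esub> t"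
    have k: "k \<in> carrier G" using G.nat_pow_closed[OF w] by (simp only: k_def)
    have d: "d \<in> carrier G" using k t unfolding d_def by (intro G.m_closed G.inv_closed)
    have c: "?c p i \<in> carrier G" for i
      unfolding p' prod.case using w s t by (intro G.m_closed G.inv_closed G.nat_pow_closed)
    have "w [^]\<^bsub>G\<^esub> n = k \<otimes>\<^bsub>G\<^esub> w [^]\<^bsub>G\<^esub> m"
      using G.nat_pow_mult[OF w, of "n - m" m] \<open>m < n\<close> by (simp add: k_def)
    then have cn: "?c p n = d \<otimes>\<^bsub>G\<^esub> ?c p m"
      using w s t k by (simp add: p' d_def G.m_assoc G.mult_inv_cancel del: carrier_G)
    have "(d \<otimes>\<^bsub>G\<^esub> v) \<otimes>\<^bsub>G\<^esub> ?c p m = d \<otimes>\<^bsub>G\<^esub> (?c p m \<otimes>\<^bsub>G\<^esub> v)"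
      using m d v c by (simp add: bad_def G.m_assoc del: carrier_G)
    also have "\<dots> = ?c p n \<otimes>\<^bsub>G\<^esub> v"
      using d v c by (simp only: cn G.m_assoc)
    also have "\<dots> = v \<otimes>\<^bsub>G\<^esub> ?c p n"
      using n by (simp add: bad_def)
    also have "\<dots> = (v \<otimes>\<^bsub>G\<^esub> d) \<otimes>\<^bsub>G\<^esub> ?c p m"
      using d v c by (simp only: cn G.m_assoc)
    finally have dv: "d \<otimes>\<^bsub>G\<^esub> v = v \<otimes>\<^bsub>G\<^esub> d"
      using G.right_cancel[OF c G.m_closed[OF d v] G.m_closed[OF v d]] by blast
    have "(t \<otimes>\<^bsub>G\<^esub> v \<otimes>\<^bsub>G\<^esub> inv\<^bsub>G\<^esub> t) \<otimes>\<^bsub>G\<^esub> k = t \<otimes>\<^bsub>G\<^esub> (v \<otimes>\<^bsub>G\<^esub> d) \<otimes>\<^bsub>G\<^esub> inv\<^bsub>G\<^esub> t"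
      using v t k by (simp add: d_def G.m_assoc del: carrier_G)
    also have "\<dots> = k \<otimes>\<^bsub>G\<^esub> (t \<otimes>\<^bsub>G\<^esub> v \<otimes>\<^bsub>G\<^esub> inv\<^bsub>G\<^esub> t)"
      unfolding dv[symmetric] using v t k by (simp add: d_def G.m_assoc G.mult_inv_cancel del: carrier_G)
    finally show False using nc[of "n - m" t] t \<open>m < n\<close> unfolding k_def by simp
  qed
  have "finite (bad p)" if "p \<in> T \<times> T" for p
  proof (cases "bad p = {}")
    case False
    then obtain m where "m \<in> bad p" by blast
    then have "bad p \<subseteq> {m}" using uniq[OF that] by (metis linorder_neqE_nat singletonI subsetI)
    then show ?thesis using finite_subset by blast
  qed simp
  then have "finite (\<Union>p\<in>T \<times> T. bad p)" using T(1) by blast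
  then obtain m where "m \<notin> (\<Union>p\<in>T \<times> T. bad p)" using ex_new_if_finite infinite_UNIV_nat by blast
  then show ?thesis by (intro exI[of _ m]) (auto simp: bad_def)
qed

text \<open>First \<open>m\<close> and \<open>H\<close> are fixed so that no orbit of
  \<open>v\<close> meets both marks. The order of \<open>v\<close> in the twist is then at most
  twice \<open>order H\<close> whatever \<open>L\<close> is, while \<open>L\<close> divides the
  order of \<open>w\<close>.\<close>

lemma orders_differ_incommensurable:
  assumes "residually_finite G" and w: "alternating w" "primitive_list w" and v: "v \<in> carrier G"
    and nc: "\<And>k g. 0 < k \<Longrightarrow> g \<in> carrier G \<Longrightarrow>
      (g \<otimes>\<^bsub>G\<^esub> v \<otimes>\<^bsub>G\<^esub> inv\<^bsub>G\<^esub> g) \<otimes>\<^bsub>G\<^esub> w [^]\<^bsub>G\<^esub> (k :: nat) \<noteq> w [^]\<^bsub>G\<^esub> k \<otimes>\<^bsub>G\<^esub> (g \<otimes>\<^bsub>G\<^esub> v \<otimes>\<^bsub>G\<^esub> inv\<^bsub>G\<^esub> g)"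
    and r: "0 < (r :: nat)"
  shows "orders_differ G (w [^]\<^bsub>G\<^esub> r) v"
proof -
  have wc: "w \<in> carrier G" using w by (auto simp: alternating_def)
  let ?T = "(\<lambda>i. drop i v) ` {..length v}"
  have T: "finite ?T" "?T \<subseteq> carrier G" using v by auto
  obtain m :: nat where m: "\<And>s t. s \<in> ?T \<Longrightarrow> t \<in> ?T \<Longrightarrow>
    inv\<^bsub>G\<^esub> t \<otimes>\<^bsub>G\<^esub> w [^]\<^bsub>G\<^esub> m \<otimes>\<^bsub>G\<^esub> s \<otimes>\<^bsub>G\<^esub> v \<noteq> v \<otimes>\<^bsub>G\<^esub> (inv\<^bsub>G\<^esub> t \<otimes>\<^bsub>G\<^esub> w [^]\<^bsub>G\<^esub> m \<otimes>\<^bsub>G\<^esub> s)"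
    using exists_not_commute[OF wc v nc T] by blast
  \<comment> \<open>\<open>psi_pow_eq_one\<close> ranges over all indices; those beyond the length
    give the empty suffix.\<close>
  have dropT: "drop i v \<in> ?T" for i
    by (cases "i \<le> length v") (auto intro: image_eqI[of _ _ "length v"])
  let ?c = "\<lambda>s t. inv\<^bsub>G\<^esub> t \<otimes>\<^bsub>G\<^esub> w [^]\<^bsub>G\<^esub> m \<otimes>\<^bsub>G\<^esub> s"
  let ?S = "(\<lambda>i. (drop i w, w)) ` {0<..<length w} \<union> (\<lambda>(i, j). (?c (drop i v) (drop j v), v)) ` ({..length v} \<times> {..length v})"
  have S: "finite ?S" "?S \<subseteq> carrier G \<times> carrier G"
    using wc v by auto
  have nc': "x \<otimes>\<^bsub>G\<^esub> y \<noteq> y \<otimes>\<^bsub>G\<^esub> x" if "(x, y) \<in> ?S" for x y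
    using that drop_not_commute[OF w] m[OF dropT dropT] by auto
  \<comment> \<open>For two empty suffixes the element supplied by \<open>m\<close> is the power of
    \<open>w\<close> itself. As it does not commute with \<open>v\<close>, it is nontrivial.\<close>
  have "w [^]\<^bsub>G\<^esub> m \<noteq> \<one>\<^bsub>G\<^esub>"
    using m[OF dropT[of "length v"] dropT[of "length v"]] v by (auto simp flip: one_G simp del: carrier_G)
  then obtain H :: "nat monoid" and \<phi> where \<phi>: "finite_hom G H \<phi>" "\<phi> (w [^]\<^bsub>G\<^esub> m) \<noteq> \<one>\<^bsub>H\<^esub>"
    "\<And>x y. (x, y) \<in> ?S \<Longrightarrow> \<phi> x \<otimes>\<^bsub>H\<^esub> \<phi> y \<noteq> \<phi> y \<otimes>\<^bsub>H\<^esub> \<phi> x"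
    using residually_finite_not_commute[OF G.group_axioms assms(1) S nc' G.nat_pow_closed[OF wc]] by blast
  interpret \<phi>: group_hom G H \<phi> using finite_hom_group_hom[OF G.group_axioms \<phi>(1)] .
  have finH: "finite (carrier H)" using \<phi>(1) by (simp add: finite_hom_def)
  have cm: "\<phi> (w [^]\<^bsub>G\<^esub> m) = \<phi> w [^]\<^bsub>H\<^esub> m" using \<phi>.hom_nat_pow[OF wc] .
  \<comment> \<open>The factor \<open>r\<close> pays for passing from \<open>w\<close> to its power
    with exponent \<open>r\<close>, and \<open>Suc\<close> makes the final inequality
    strict.\<close>
  define L c where "L = Suc (2 * r * order H)" and "c = \<phi> w [^]\<^bsub>H\<^esub> m"
  interpret T: twisted_action A B H \<phi> c "int L"
  proof unfold_locales
    show "0 < int L" unfolding L_def by (simp only: of_nat_0_less_iff zero_less_Suc)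
  qed (use \<phi>(1,2) wc cm in \<open>auto simp: c_def simp del: carrier_G\<close>)
  have "int L dvd int (T.\<psi>.H.ord (T.\<psi> w))"
  proof (rule T.L_dvd_ord[OF w(1) _ c_def])
    fix i assume "0 < i" "i < length w"
    then show "\<phi> (drop i w) \<otimes>\<^bsub>H\<^esub> \<phi> w \<noteq> \<phi> w \<otimes>\<^bsub>H\<^esub> \<phi> (drop i w)"
      by (intro \<phi>(3)) auto
  qed
  then have dvd: "L dvd T.\<psi>.H.ord (T.\<psi> w)" by (simp only: int_dvd_int_iff)
  have one: "T.\<psi> v [^]\<^bsub>T.K\<^esub> (\<phi>.H.ord (\<phi> v) * 2) = \<one>\<^bsub>T.K\<^esub>"
  proof (rule T.psi_pow_eq_one)
    fix i j
    have "\<phi> (?c (drop i v) (drop j v)) = inv\<^bsub>H\<^esub> \<phi> (drop j v) \<otimes>\<^bsub>H\<^esub> c \<otimes>\<^bsub>H\<^esub> \<phi> (drop i v)"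
      using v wc by (simp add: cm c_def)
    moreover have "(?c (drop i v) (drop j v), v) \<in> ?S"
      by (intro UnI2 image_eqI[of _ _ "(min i (length v), min j (length v))"]) (auto simp: min_def)
    ultimately show "inv\<^bsub>H\<^esub> \<phi> (drop j v) \<otimes>\<^bsub>H\<^esub> c \<otimes>\<^bsub>H\<^esub> \<phi> (drop i v) \<otimes>\<^bsub>H\<^esub> \<phi> v \<noteq>
       \<phi> v \<otimes>\<^bsub>H\<^esub> (inv\<^bsub>H\<^esub> \<phi> (drop j v) \<otimes>\<^bsub>H\<^esub> c \<otimes>\<^bsub>H\<^esub> \<phi> (drop i v))"
      using \<phi>(3) by metis
  qed (use v in simp)
  have finK: "finite (carrier T.K)" using T.finite_hom_psi by (simp add: finite_hom_def)
  have pw: "T.\<psi> w \<in> carrier T.K" and pv: "T.\<psi> v \<in> carrier T.K" using wc v by simp_all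
  have "T.\<psi>.H.ord (T.\<psi> v) dvd \<phi>.H.ord (\<phi> v) * 2"
    using one T.\<psi>.H.pow_eq_id[OF pv] by simp
  moreover have phv: "\<phi> v \<in> carrier H" using v by simp
  moreover have "0 < \<phi>.H.ord (\<phi> v)" using \<phi>.H.ord_ge_1[OF finH phv] by simp
  ultimately have "T.\<psi>.H.ord (T.\<psi> v) \<le> \<phi>.H.ord (\<phi> v) * 2" by (intro dvd_imp_le) auto
  also have "\<dots> \<le> 2 * order H"
    using \<phi>.H.ord_le_group_order[OF finH phv] by simp
  finally have ordv: "T.\<psi>.H.ord (T.\<psi> v) \<le> 2 * order H" .
  define N where "N = T.\<psi>.H.ord (T.\<psi> w [^]\<^bsub>T.K\<^esub> r)"
  have "T.\<psi> w [^]\<^bsub>T.K\<^esub> (r * N) = \<one>\<^bsub>T.K\<^esub>"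
    using pw T.\<psi>.H.nat_pow_pow[OF pw, of r N] T.\<psi>.H.pow_ord_eq_1 by (simp add: N_def)
  then have "L dvd r * N" using dvd T.\<psi>.H.pow_eq_id[OF pw] dvd_trans by blast
  moreover have "0 < N" using T.\<psi>.H.ord_ge_1[OF finK, of "T.\<psi> w [^]\<^bsub>T.K\<^esub> r"] pw by (simp add: N_def)
  ultimately have "L \<le> r * N" using r by (intro dvd_imp_le) auto
  then have "r * (2 * order H) < r * N" by (simp only: L_def Suc_le_eq ac_simps)
  then have "T.\<psi>.H.ord (T.\<psi> v) < N" using ordv by simp
  then have "T.\<psi>.H.ord (T.\<psi> (w [^]\<^bsub>G\<^esub> r)) \<noteq> T.\<psi>.H.ord (T.\<psi> v)"
    using wc T.\<psi>.hom_nat_pow[of w r] by (simp add: N_def)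
  then show ?thesis
    using orders_differI[OF G.group_axioms T.finite_hom_psi _ v(1)] wc G.nat_pow_closed by blast
qed

text \<open>With \<open>w\<close> the primitive root of \<open>u\<close>, the cases are whether some
  conjugate of \<open>v\<close> commutes with a positive power of \<open>w\<close>. If so, it is a
  power of \<open>w\<close> up to inversion, and exponent \<open>r\<close> would make
  \<open>u\<close> conjugate to \<open>v\<close> or its inverse.\<close>

lemma orders_differ_alternating:
  assumes "residually_finite G" "alternating u" "v \<in> carrier G"
    and "\<not> conjugate_in G u v" "\<not> conjugate_in G u (inv\<^bsub>G\<^esub> v)"
  shows "orders_differ G u v"
proof -
  obtain w r where w: "primitive_list w" "0 < r" "u = concat (replicate r w)"
    using primitive_root_exists[of u] assms(2) by (auto simp: alternating_def)
  have alt: "alternating w" using alternating_root assms(2) w(3) by blast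
  then have u: "u = w [^]\<^bsub>G\<^esub> r" using alternating_pow w(3) by simp
  have uc: "u \<in> carrier G" using assms(2) by (simp add: alternating_def)
  show ?thesis
  proof (cases "\<exists>k g. 0 < k \<and> g \<in> carrier G \<and>
      (g \<otimes>\<^bsub>G\<^esub> v \<otimes>\<^bsub>G\<^esub> inv\<^bsub>G\<^esub> g) \<otimes>\<^bsub>G\<^esub> w [^]\<^bsub>G\<^esub> (k :: nat) = w [^]\<^bsub>G\<^esub> k \<otimes>\<^bsub>G\<^esub> (g \<otimes>\<^bsub>G\<^esub> v \<otimes>\<^bsub>G\<^esub> inv\<^bsub>G\<^esub> g)")
    case True
    then obtain k g where k: "0 < (k :: nat)" and g: "g \<in> carrier G" and
      comm: "(g \<otimes>\<^bsub>G\<^esub> v \<otimes>\<^bsub>G\<^esub> inv\<^bsub>G\<^esub> g) \<otimes>\<^bsub>G\<^esub> w [^]\<^bsub>G\<^esub> k = w [^]\<^bsub>G\<^esub> k \<otimes>\<^bsub>G\<^esub> (g \<otimes>\<^bsub>G\<^esub> v \<otimes>\<^bsub>G\<^esub> inv\<^bsub>G\<^esub> g)" by blast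
    define v' where "v' = g \<otimes>\<^bsub>G\<^esub> v \<otimes>\<^bsub>G\<^esub> inv\<^bsub>G\<^esub> g"
    have conj: "conjugate_in G v v'" using g by (auto simp: conjugate_in_def v'_def simp del: carrier_G)
    have v'c: "v' \<in> carrier G" using conjugate_in_closed[OF G.group_axioms assms(3) conj] .
    obtain i :: nat where i: "v' = w [^]\<^bsub>G\<^esub> i \<or> inv\<^bsub>G\<^esub> v' = w [^]\<^bsub>G\<^esub> i"
      using centralizer_alternating[OF alt w(1) k v'c] comm unfolding v'_def by blast
    have "i \<noteq> r"
    proof
      assume "i = r"
      then have "v' = u \<or> inv\<^bsub>G\<^esub> v' = u" using i u by simp
      moreover have "conjugate_in G v' v"
        using conjugate_in_sym[OF G.group_axioms assms(3) conj] .
      moreover have "conjugate_in G (inv\<^bsub>G\<^esub> v') (inv\<^bsub>G\<^esub> v)"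
        using conjugate_in_inv[OF G.group_axioms v'c] calculation(2) .
      ultimately show False using assms(4,5) by auto
    qed
    then show ?thesis
      using orders_differ_commensurable[OF assms(1) alt w(1,2) _ assms(3) conj i] u by simp
  next
    case False
    then show ?thesis
      using orders_differ_incommensurable[OF assms(1) alt w(1) assms(3) _ w(2)] u by blast
  qed
qed

section \<open>Retractions onto the factors and the final case analysis\<close>

abbreviation proj_A where "proj_A \<equiv> free_product_lift A (\<lambda>x. x) (\<lambda>_. \<one>\<^bsub>A\<^esub>)"
abbreviation proj_B where "proj_B \<equiv> free_product_lift B (\<lambda>_. \<one>\<^bsub>B\<^esub>) (\<lambda>x. x)"

lemma proj_hom: "proj_A \<in> hom G A" "proj_B \<in> hom G B"
  by (rule free_product_lift; auto simp: hom_def A.group_axioms B.group_axioms)+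

lemma proj_inl: "a \<in> carrier A \<Longrightarrow> proj_A (free_product_inl A a) = a"
    "a \<in> carrier A \<Longrightarrow> proj_B (free_product_inl A a) = \<one>\<^bsub>B\<^esub>"
  and proj_inr: "b \<in> carrier B \<Longrightarrow> proj_A (free_product_inr B b) = \<one>\<^bsub>A\<^esub>"
    "b \<in> carrier B \<Longrightarrow> proj_B (free_product_inr B b) = b"
  by (simp_all add: free_product_lift_def free_product_inl_def free_product_inr_def)

text \<open>At least one of \<open>a\<close> and \<open>b\<close> is nontrivial. Projecting to its
  factor kills the other, and residual finiteness of that factor keeps it alive.\<close>

lemma orders_differ_factor:
  assumes "residually_finite A" "residually_finite B"
    and "a \<in> carrier A" "b \<in> carrier B" "free_product_inl A a \<noteq> free_product_inr B b"
  shows "orders_differ G (free_product_inl A a) (free_product_inr B b)"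
proof (cases "a = \<one>\<^bsub>A\<^esub>")
  case False
  then obtain H :: "nat monoid" and \<phi> where \<phi>: "finite_hom A H \<phi>" "\<phi> a \<noteq> \<one>\<^bsub>H\<^esub>"
    using assms by (auto simp: residually_finite_def)
  interpret group_hom A H \<phi> using finite_hom_group_hom[OF A.group_axioms \<phi>(1)] .
  have "finite_hom G H (\<phi> \<circ> proj_A)" using finite_hom_compose[OF proj_hom(1) \<phi>(1)] .
  moreover have "H.ord (\<phi> a) \<noteq> 1" using H.ord_eq_1 assms(3) \<phi>(2) by simp
  ultimately show ?thesis
    using assms unfolding orders_differ_def
    by (intro exI[of _ H] exI[of _ "\<phi> \<circ> proj_A"]) (simp add: proj_inl proj_inr)
next
  case True
  then have "b \<noteq> \<one>\<^bsub>B\<^esub>" using assms(5) by (auto simp: free_product_inl_def free_product_inr_def)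
  then obtain H :: "nat monoid" and \<phi> where \<phi>: "finite_hom B H \<phi>" "\<phi> b \<noteq> \<one>\<^bsub>H\<^esub>"
    using assms by (auto simp: residually_finite_def)
  interpret group_hom B H \<phi> using finite_hom_group_hom[OF B.group_axioms \<phi>(1)] .
  have "finite_hom G H (\<phi> \<circ> proj_B)" using finite_hom_compose[OF proj_hom(2) \<phi>(1)] .
  moreover have "H.ord (\<phi> b) \<noteq> 1" using H.ord_eq_1 assms(4) \<phi>(2) by simp
  ultimately show ?thesis
    using assms unfolding orders_differ_def
    by (intro exI[of _ H] exI[of _ "\<phi> \<circ> proj_B"]) (auto simp add: proj_inl proj_inr)
qed

end

lemma orders_differ_hom:
  assumes "\<pi> \<in> hom G A" "orders_differ A (\<pi> u) (\<pi> v)"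
  shows "orders_differ G u v"
proof -
  obtain H :: "nat monoid" and \<phi> where "finite_hom A H \<phi>" "group.ord H (\<phi> (\<pi> u)) \<noteq> group.ord H (\<phi> (\<pi> v))"
    using assms(2) by (auto simp: orders_differ_def)
  then show ?thesis
    using finite_hom_compose[OF assms(1)] unfolding orders_differ_def
    by (intro exI[of _ H] exI[of _ "\<phi> \<circ> \<pi>"]) simp
qed

text \<open>Conjugacy in \<open>G\<close> descends along \<pi>, so elements not conjugate in
  \<open>A\<close> have non-conjugate images in \<open>G\<close>; separating quotients pull back
  along \<iota>.\<close>

lemma order_separable_retract:
  assumes "group A" "group G" and \<iota>: "\<iota> \<in> hom A G" and \<pi>: "\<pi> \<in> hom G A"
    and inv: "\<And>a. a \<in> carrier A \<Longrightarrow> \<pi> (\<iota> a) = a" and "order_separable G"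
  shows "order_separable A"
  unfolding order_separable_iff[OF assms(1)]
proof (intro ballI impI)
  fix u v
  assume u: "u \<in> carrier A" and v: "v \<in> carrier A"
    and nc: "\<not> conjugate_in A u v \<and> \<not> conjugate_in A u (inv\<^bsub>A\<^esub> v)"
  interpret \<iota>: group_hom A G \<iota> using assms by (simp add: group_hom_def group_hom_axioms_def)
  have \<pi>: "group_hom G A \<pi>" using assms by (simp add: group_hom_def group_hom_axioms_def)
  have "\<not> conjugate_in G (\<iota> u) (\<iota> w)" if "w \<in> carrier A" "\<not> conjugate_in A u w" for w
    using conjugate_in_hom[OF \<pi>, of "\<iota> u" "\<iota> w"] that u inv by auto
  then have "\<not> conjugate_in G (\<iota> u) (\<iota> v)" "\<not> conjugate_in G (\<iota> u) (inv\<^bsub>G\<^esub> (\<iota> v))"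
    using nc v by (simp_all flip: \<iota>.hom_inv)
  then have "orders_differ G (\<iota> u) (\<iota> v)"
    using assms(6) u v by (simp add: order_separable_iff[OF assms(2)])
  then show "orders_differ A u v" by (rule orders_differ_hom[OF \<iota>])
qed

context two_groups
begin

text \<open>Up to conjugacy each element lies in a factor or is alternating.
  \<open>orders_differ_alternating\<close> handles an alternating one and
  \<open>orders_differ_factor\<close> elements of different factors; within one factor, a separating
  quotient is pulled back along the projection.\<close>

lemma order_separable_free_product:
  assumes A: "order_separable A" and B: "order_separable B"
  shows "order_separable G"
  unfolding order_separable_iff[OF G.group_axioms]
proof (intro ballI impI)
  have rA: "residually_finite A" and rB: "residually_finite B"
    using assms residually_finite_if_order_separable A.group_axioms B.group_axioms by blast+
  have rG: "residually_finite G" using residually_finite_free_product[OF rA rB] .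
  interpret inl: group_hom A G "free_product_inl A"
    using free_product_inl_hom by unfold_locales
  interpret inr: group_hom B G "free_product_inr B"
    using free_product_inr_hom by unfold_locales
  fix u0 v0
  assume u0: "u0 \<in> carrier G" and v0: "v0 \<in> carrier G"
    and nc0: "\<not> conjugate_in G u0 v0 \<and> \<not> conjugate_in G u0 (inv\<^bsub>G\<^esub> v0)"
  let ?form = "\<lambda>g. (\<exists>a\<in>carrier A. g = free_product_inl A a) \<or> (\<exists>b\<in>carrier B. g = free_product_inr B b) \<or> alternating g"
  obtain u where u: "conjugate_in G u0 u" "?form u" using conjugate_cyclically_reduced[OF u0] by blast
  obtain v where v: "conjugate_in G v0 v" "?form v" using conjugate_cyclically_reduced[OF v0] by blast
  have uc: "u \<in> carrier G" and vc: "v \<in> carrier G"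
    using conjugate_in_closed[OF G.group_axioms] u0 v0 u(1) v(1) by blast+
  have vu: "conjugate_in G v v0" "conjugate_in G (inv\<^bsub>G\<^esub> v) (inv\<^bsub>G\<^esub> v0)"
    using conjugate_in_sym[OF G.group_axioms v0 v(1)] conjugate_in_inv[OF G.group_axioms vc] by blast+
  have nc: "\<not> conjugate_in G u v" "\<not> conjugate_in G u (inv\<^bsub>G\<^esub> v)"
    using nc0 conjugate_in_trans[OF G.group_axioms u0] u(1) vu by blast+
  \<comment> \<open>The same facts with exchanged roles, for the case that \<open>v\<close> is the
    alternating word.\<close>
  have nc': "\<not> conjugate_in G v u" "\<not> conjugate_in G v (inv\<^bsub>G\<^esub> u)"
    using nc conjugate_in_sym[OF G.group_axioms vc] conjugate_in_inv[OF G.group_axioms vc, of "inv\<^bsub>G\<^esub> u"]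
      conjugate_in_sym[OF G.group_axioms, of "inv\<^bsub>G\<^esub> v" u] G.inv_closed[OF vc] G.inv_inv[OF uc] by auto
  have "u \<noteq> v"
  proof
    assume "u = v"
    then show False
      using nc(1) uc G.one_closed unfolding conjugate_in_def by (metis G.inv_one G.l_one G.r_one)
  qed
  have "orders_differ G u v"
  proof (cases "alternating u \<or> alternating v")
    case True
    then show ?thesis
    proof
      assume "alternating u"
      then show ?thesis by (rule orders_differ_alternating[OF rG _ vc nc])
    next
      assume "alternating v"
      then show ?thesis by (rule orders_differ_sym[OF orders_differ_alternating[OF rG _ uc nc']])
    qed
  next
    case False
    show ?thesis
      using u(2)
    proof (elim disjE bexE)
      fix a assume a: "a \<in> carrier A" "u = free_product_inl A a"
      show ?thesis
        using v(2)
      proof (elim disjE bexE)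
        fix a' assume a': "a' \<in> carrier A" "v = free_product_inl A a'"
        have "\<not> conjugate_in A a a'" "\<not> conjugate_in A a (inv\<^bsub>A\<^esub> a')"
          using nc conjugate_in_hom[OF inl.group_hom_axioms a(1)] inl.hom_inv[OF a'(1)] a(2) a'(2) by metis+
        then have "orders_differ A a a'"
          using A a a' by (simp add: order_separable_iff[OF A.group_axioms])
        then show ?thesis
          using a a' by (intro orders_differ_hom[OF proj_hom(1)]) (simp add: proj_inl)
      next
        fix b assume "b \<in> carrier B" "v = free_product_inr B b"
        then show ?thesis using orders_differ_factor[OF rA rB a(1)] a(2) \<open>u \<noteq> v\<close> by simp
      qed (use False in blast)
    next
      fix b assume b: "b \<in> carrier B" "u = free_product_inr B b"
      show ?thesis
        using v(2)
      proof (elim disjE bexE)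
        fix a assume "a \<in> carrier A" "v = free_product_inl A a"
        then show ?thesis
          using orders_differ_sym[OF orders_differ_factor[OF rA rB _ b(1)]] b(2) \<open>u \<noteq> v\<close> by metis
      next
        fix b' assume b': "b' \<in> carrier B" "v = free_product_inr B b'"
        have "\<not> conjugate_in B b b'" "\<not> conjugate_in B b (inv\<^bsub>B\<^esub> b')"
          using nc conjugate_in_hom[OF inr.group_hom_axioms b(1)] inr.hom_inv[OF b'(1)] b(2) b'(2) by metis+
        then have "orders_differ B b b'"
          using B b b' by (simp add: order_separable_iff[OF B.group_axioms])
        then show ?thesis
          using b b' by (intro orders_differ_hom[OF proj_hom(2)]) (simp add: proj_inr)
      qed (use False in blast)
    qed (use False in blast)
  qed
  then show "orders_differ G u0 v0"
    using orders_differ_conjugate_in[OF G.group_axioms u0 v0 u(1) v(1)] by blast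
qed

end

theorem theorem1:
  fixes A :: "('a, 'm) monoid_scheme" and B :: "('b, 'n) monoid_scheme"
  assumes "group A" and "group B"
  shows "order_separable (free_product A B) \<longleftrightarrow> order_separable A \<and> order_separable B"
proof -
  interpret two_groups A B using assms by (simp add: two_groups_def)
  show ?thesis
    using order_separable_retract[OF assms(1) G.group_axioms free_product_inl_hom proj_hom(1) proj_inl(1)]
      order_separable_retract[OF assms(2) G.group_axioms free_product_inr_hom proj_hom(2) proj_inr(2)]
      order_separable_free_product by blast
qed

end
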